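(* Let $A:\mathcal{H}\to 2^{\mathcal{H}}$ be maximally monotone with $\operatorname{zer}A\neq\varnothing$, let $u,x_0\in\mathcal{H}$, let $(e_k)_{k\in\mathbb{N}}$ be a sequence in $\mathcal{H}$, let $(c_k)_{k\in\mathbb{N}}$ be a sequence of strictly positive reals, let $(\alpha_k)_{k\in\mathbb{N}},(\beta_k)_{k\in\mathbb{N}},(\gamma_k)_{k\in\mathbb{N}},(\delta_k)_{k\in\mathbb{N}}$ be sequences in $\mathbb{R}$, and let $(x_k)_{k\in\mathbb{N}}$ be generated by $$(\forall k\in\mathbb{N})\quad x_{k+1}=\alpha_k u+\beta_k x_k+\gamma_k J_{c_kA}(x_k)+\delta_k e_k .$$ Suppose that $\sum_{k\in\mathbb{N}}\left(1-\left(\left|\beta_k+\frac{\gamma_k}{2}\right|+\left|\frac{\gamma_k}{2}\right|\right)^2\right)=\infty$ and that one of the following holds. (i) $(\forall k\in\mathbb{N})$ $|\alpha_k|+\left|\beta_k+\frac{\gamma_k}{2}\right|+\left|\frac{\gamma_k}{2}\right|\le 1$, $\beta_k+\gamma_k\ge 0$, and $\left(\left|\beta_k+\frac{\gamma_k}{2}\right|+\left|\frac{\gamma_k}{2}\right|\right)^2-\beta_k-\gamma_k\le 0$; $\sum_{k\in\mathbb{N}}|1-\alpha_k-\beta_k-\gamma_k|<\infty$ and $\sum_{k\in\mathbb{N}}\|\delta_ke_k\|<\infty$; and $\alpha_k\to 0$, $\beta_k\to 0$, $\gamma_k\to 1$, and $c_k\to\infty$. (ii) $(\forall k\in\mathbb{N})$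 $|\alpha_k|+\left|\beta_k+\frac{\gamma_k}{2}\right|+\left|\frac{\gamma_k}{2}\right|\le 1$, $\beta_k+\gamma_k\ge 0$, and $\left(\left|\beta_k+\frac{\gamma_k}{2}\right|+\left|\frac{\gamma_k}{2}\right|\right)^2-\beta_k-\gamma_k\le 0$; $\sum_{k\in\mathbb{N}}|1-\alpha_k-\beta_k-\gamma_k|<\infty$ and $\sum_{k\in\mathbb{N}}\|\delta_ke_k\|<\infty$; $\alpha_k\to 0$, $\limsup_{k\to\infty}|\beta_k|<1$, $0<\liminf_{k\to\infty}\left(1-\beta_k-\frac{\gamma_k}{2}\right)\le\limsup_{k\to\infty}\left(1-\beta_k-\frac{\gamma_k}{2}\right)<1$, and $1-\frac{c_k}{c_{k+1}}\to 0$; and [$\inf_{k\in\mathbb{N}}c_k>0$ or $c_k\to\infty$]. (iii) $(\forall k\in\mathbb{N})$ $|\alpha_k|+\left|\beta_k+\frac{\gamma_k}{2}\right|+\left|\frac{\gamma_k}{2}\right|\le 1$, $\beta_k+\gamma_k\ge 0$, $\left(\left|\beta_k+\frac{\gamma_k}{2}\right|+\left|\frac{\gamma_k}{2}\right|\right)^2-\beta_k-\gamma_k\le 0$, and $|\gamma_k|\in[0,1]$; $\sum_{k\in\mathbb{N}}|(\alpha_{k+1}+\gamma_{k+1})-(\alpha_k+\gamma_k)|<\infty$, $\sum_{k\in\mathbb{N}}|1-\alpha_k-\beta_k-\gamma_k|<\infty$, $\sum_{k\in\mathbb{N}}|\beta_k|<\infty$, $\sum_{k\in\mathbb{N}}(1-|\gamma_k|)=\infty$,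 and $\sum_{k\in\mathbb{N}}\|\delta_ke_k\|<\infty$; $\sum_{k\in\mathbb{N}}|\alpha_{k+1}-\alpha_k|<\infty$ or [$(\forall k\in\mathbb{N})$ $|\gamma_k|\ne1$ with $\lim_{k\to\infty}\frac{|\alpha_{k+1}-\alpha_k|}{1-|\gamma_{k+1}|}=0$]; $\alpha_k\to 0$ and $\alpha_k+\gamma_k\to 1$; and $\inf_{k\in\mathbb{N}}c_k>0$ and $\sum_{k\in\mathbb{N}}|c_{k+1}-c_k|<\infty$. (iv) $(\forall k\in\mathbb{N})$ $\alpha_k\in\left]0,1\right]$ and $\alpha_k+\left|\beta_k+\frac{\gamma_k}{2}\right|+\left|\frac{\gamma_k}{2}\right|\le 1$; and $\alpha_k\to 0$, $\beta_k\to 0$, $\gamma_k\to 1$, $\frac{\delta_ke_k}{\alpha_k}\to 0$, $\frac{1-\alpha_k-\beta_k-\gamma_k}{\alpha_k}\to 0$, and $c_k\to\infty$. Then $x_k\to P_{\operatorname{zer}A}u$ strongly (in norm).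
   Context: $\mathcal{H}\neq\{0\}$ is a real Hilbert space with inner product $\langle\cdot,\cdot\rangle$ and induced norm $\|\cdot\|$; $\mathbb{N}=\{0,1,2,\ldots\}$. A set-valued operator $A:\mathcal{H}\to 2^{\mathcal{H}}$ has graph $\operatorname{gra}A=\{(x,w): w\in A(x)\}$; it is monotone if $\langle x-y,w-v\rangle\ge 0$ for all $(x,w),(y,v)\in\operatorname{gra}A$, and maximally monotone if moreover no monotone operator has a graph properly containing $\operatorname{gra}A$. $\operatorname{zer}A=\{x\in\mathcal{H}: 0\in A(x)\}$, which is closed and convex when $A$ is maximally monotone. For $c>0$, $J_{cA}=(\mathrm{Id}+cA)^{-1}$ is the resolvent of $cA$; for $A$ maximally monotone it is a single-valued map defined on all of $\mathcal{H}$. For a nonempty closed convex set $C\subseteq\mathcal{H}$, $P_C$ is the projector onto $C$, mapping each point to its unique nearest point in $C$. *)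

theory Defs
  imports "HOL-Analysis.Analysis"
begin

text \<open>
  A set-valued operator on \<open>\<H>\<close> is a function of type \<open>'a \<Rightarrow> 'a set\<close>, where
  \<open>'a :: {real_inner, complete_space}\<close> is a real Hilbert space.
\<close>

definition gra :: "('a \<Rightarrow> 'b set) \<Rightarrow> ('a \<times> 'b) set"
  where "gra A = {(x, w). w \<in> A x}"

definition zer :: "('a \<Rightarrow> 'b::zero set) \<Rightarrow> 'a set"
  where "zer A = {x. 0 \<in> A x}"

definition monotone_operator :: "('a::real_inner \<Rightarrow> 'a set) \<Rightarrow> bool"
  where "monotone_operator A \<longleftrightarrow>
    (\<forall>(x, w) \<in> gra A. \<forall>(y, v) \<in> gra A. inner (x - y) (w - v) \<ge> 0)"

definition maximally_monotone :: "('a::real_inner \<Rightarrow> 'a set) \<Rightarrow> bool"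
  where "maximally_monotone A \<longleftrightarrow>
    monotone_operator A \<and> \<not> (\<exists>B. monotone_operator B \<and> gra A \<subset> gra B)"

definition inverse_operator :: "('a \<Rightarrow> 'b set) \<Rightarrow> 'b \<Rightarrow> 'a set"
  where "inverse_operator A u = {x. u \<in> A x}"

definition id_plus_scaled :: "real \<Rightarrow> ('a::real_vector \<Rightarrow> 'a set) \<Rightarrow> 'a \<Rightarrow> 'a set"
  where "id_plus_scaled c A x = {x + c *\<^sub>R w | w. w \<in> A x}"

text \<open>
  The resolvent \<open>J\<^sub>c\<^sub>A = (Id + cA)\<^sup>-\<^sup>1\<close> as a single-valued map.  The description is
  proper (the set has exactly one element) when \<open>A\<close> is maximally monotone and \<open>c > 0\<close>;
  outside that case the value is unspecified.
\<close>

definition resolvent :: "real \<Rightarrow> ('a::real_vector \<Rightarrow> 'a set) \<Rightarrow> 'a \<Rightarrow> 'a"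
  where "resolvent c A x = (THE p. p \<in> inverse_operator (id_plus_scaled c A) x)"

text \<open>
  The library's \<^const>\<open>closest_point\<close> lives in class \<^class>\<open>heine_borel\<close>, which would force
  finite dimension.  The description below is proper when \<open>C\<close> is nonempty, closed and
  convex in a Hilbert space.
\<close>

definition projector :: "'a::real_inner set \<Rightarrow> 'a \<Rightarrow> 'a"
  where "projector C u = (THE p. p \<in> C \<and> (\<forall>y\<in>C. norm (u - p) \<le> norm (u - y)))"

end

theory Submission
  imports Defs
begin

text \<open>
  Let \<open>z\<close> be the projection of \<open>u\<close> onto the zeros of \<open>A\<close> and \<open>J\<close> the resolvent with the current
  parameter.  With \<open>a = \<beta> + \<gamma> / 2\<close> and \<open>b = \<gamma> / 2\<close> the iteration reads
  \<open>x' - z = \<alpha> (u - z) + a (x - z) + b (R x - z) + g\<close>, where the reflection \<open>R = 2 J - Id\<close> does not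
  increase the distance to \<open>z\<close>, and where \<open>g\<close> collects the given error and the defect of the
  coefficient sum \<open>\<alpha> + \<beta> + \<gamma>\<close> from \<open>1\<close>.

  All four sets of hypotheses lead to one situation: \<open>a\<close> and \<open>b\<close> are eventually bounded away from \<open>0\<close>,
  \<open>a + b\<close> tends to \<open>1\<close>, the parameters \<open>c\<close> are eventually bounded away from \<open>0\<close>, and with
  \<open>t = 1 - (|a| + |b|)\<^sup>2\<close>, whose sum diverges, \<open>g\<close> and the negative part of \<open>\<alpha>\<close> are \<open>o(t)\<close> plus a
  summable sequence.  Then \<open>x\<close> is bounded, and \<open>s = |x - z|\<^sup>2\<close> satisfies two estimates.  On the one hand
  \<open>s' \<le> (1 - t) s + 2 t max \<langle>u - z, x' - z\<rangle> 0\<close> up to errors.  On the other hand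
  \<open>s' \<le> s - 4 \<kappa>\<^sup>2 |x - J x|\<^sup>2 + o(1)\<close> for some \<open>\<kappa> > 0\<close>.  If \<open>|x - J x|\<close> is small, the angle
  \<open>\<langle>u - z, x' - z\<rangle>\<close> is almost nonpositive; if it is not, \<open>s\<close> drops by a fixed amount, which for
  a bounded sequence is as good as a contraction.  Hence \<open>s\<close> tends to \<open>0\<close>
  (\<open>contraction_or_drop_tendsto_zero\<close>, \<open>perturbed_resolvent_iteration\<close>).

  The angle is controlled without weak limits.  The path \<open>J\<^sub>t u\<close> converges in norm to \<open>z\<close> for
  \<open>t \<rightarrow> \<infinity>\<close> (\<open>resolvent_limit\<close>), and monotonicity compares the points of this path directly with
  approximate fixed points of resolvents (\<open>resolvent_almost_fixed_angle\<close>).  That resolvents are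
  everywhere defined is Minty's theorem (\<open>minty\<close>); it is obtained by minimising the Fitzpatrick
  function plus half the squared norm, for which completeness suffices.
\<close>

section \<open>Surjectivity of the identity plus a maximally monotone operator\<close>

text \<open>
  A linear function plus half a squared norm is strongly convex, so by the parallelogram law every
  minimising sequence is Cauchy: completeness alone gives a minimiser, without weak compactness.
  The conclusion is the first-order condition \<open>0 \<le> (s - r) + \<langle>m, p - m\<rangle>\<close> there.  Here \<open>E\<close> plays the
  part of the epigraph of a closed convex function.
\<close>

lemma quadratic_minimiser:
  fixes E :: "('b::{real_inner,complete_space} \<times> real) set"
  assumes "closed E" "convex E" "E \<noteq> {}"
    and bound: "\<And>p r. (p, r) \<in> E \<Longrightarrow> 0 \<le> r + (norm p)\<^sup>2 / 2"
  obtains m r where "(m, r) \<in> E" "\<And>p s. (p, s) \<in> E \<Longrightarrow> r + (norm m)\<^sup>2 \<le> s + inner m p"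
proof -
  define \<phi> where "\<phi> q = snd q + (norm (fst q))\<^sup>2 / 2" for q :: "'b \<times> real"
  define I where "I = (INF q\<in>E. \<phi> q)"
  have bdd: "bdd_below (\<phi> ` E)"
    using bound unfolding \<phi>_def by (intro bdd_belowI2[of _ 0]) auto
  have I_le: "I \<le> \<phi> q" if "q \<in> E" for q
    unfolding I_def using bdd that by (rule cINF_lower)
  have "\<exists>q\<in>E. \<phi> q < I + 1 / real (Suc n)" for n
    using cINF_less_iff[OF \<open>E \<noteq> {}\<close> bdd, of "I + 1 / real (Suc n)"] by (simp add: I_def)
  then obtain q where q: "\<And>n. q n \<in> E" "\<And>n. \<phi> (q n) < I + 1 / real (Suc n)"
    by metis
  \<comment> \<open>The midpoint of two almost minimisers has a value lower than their mean by an eighth of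
    the squared distance, but not lower than \<open>I\<close>.\<close>
  have gap: "(dist (fst (q i)) (fst (q j)))\<^sup>2 \<le> 4 * (1 / real (Suc i) + 1 / real (Suc j))" for i j
  proof -
    have "(1/2) *\<^sub>R q i + (1/2) *\<^sub>R q j \<in> E"
      using \<open>convex E\<close> q(1) by (auto intro: convexD)
    from I_le[OF this] have "I \<le> \<phi> ((1/2) *\<^sub>R q i + (1/2) *\<^sub>R q j)" .
    also have "\<dots> = (\<phi> (q i) + \<phi> (q j)) / 2 - (dist (fst (q i)) (fst (q j)))\<^sup>2 / 8"
      by (simp add: \<phi>_def dist_norm power2_norm_eq_inner inner_simps inner_commute field_simps)
    finally show ?thesis using q(2)[of i] q(2)[of j] by argo
  qed
  have "Cauchy (\<lambda>n. fst (q n))"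
  proof (rule metric_CauchyI)
    fix e :: real assume "0 < e"
    obtain N :: nat where N: "8 / e\<^sup>2 < real N" using reals_Archimedean2 by blast
    have "dist (fst (q i)) (fst (q j)) < e" if "N \<le> i" "N \<le> j" for i j
    proof -
      have N0: "0 < real N" using N \<open>0 < e\<close> by (smt (verit) divide_pos_pos zero_less_power)
      have "1 / real (Suc i) < 1 / real N" "1 / real (Suc j) < 1 / real N"
        using that N0 by (auto intro!: divide_strict_left_mono)
      then have "(dist (fst (q i)) (fst (q j)))\<^sup>2 < 8 / real N"
        using gap[of i j] by argo
      also have "\<dots> < e\<^sup>2" using N N0 \<open>0 < e\<close> by (simp add: field_simps)
      finally show ?thesis using \<open>0 < e\<close> by (simp add: power_less_imp_less_base)
    qed
    then show "\<exists>M. \<forall>m\<ge>M. \<forall>n\<ge>M. dist (fst (q m)) (fst (q n)) < e" by blast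
  qed
  then obtain m where m: "(\<lambda>n. fst (q n)) \<longlonglongrightarrow> m"
    using Cauchy_convergent_iff convergent_def by blast
  have "(\<lambda>n. \<phi> (q n)) \<longlonglongrightarrow> I"
  proof (rule tendsto_sandwich[OF _ _ tendsto_const])
    show "\<forall>\<^sub>F n in sequentially. \<phi> (q n) \<le> I + 1 / real (Suc n)"
      using q(2) by (simp add: less_imp_le)
    show "\<forall>\<^sub>F n in sequentially. I \<le> \<phi> (q n)"
      using q(1) I_le by simp
    show "(\<lambda>n. I + 1 / real (Suc n)) \<longlonglongrightarrow> I"
      using tendsto_add[OF tendsto_const LIMSEQ_inverse_real_of_nat, of I] by (simp add: inverse_eq_divide)
  qed
  then have "(\<lambda>n. \<phi> (q n) - (norm (fst (q n)))\<^sup>2 / 2) \<longlonglongrightarrow> I - (norm m)\<^sup>2 / 2"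
    by (intro tendsto_intros m) auto
  then have "(\<lambda>n. snd (q n)) \<longlonglongrightarrow> I - (norm m)\<^sup>2 / 2" by (simp add: \<phi>_def)
  from tendsto_Pair[OF m this] have "q \<longlonglongrightarrow> (m, I - (norm m)\<^sup>2 / 2)" by simp
  with q(1) have mE: "(m, I - (norm m)\<^sup>2 / 2) \<in> E"
    using \<open>closed E\<close> closed_sequentially by blast
  define r where "r = I - (norm m)\<^sup>2 / 2"
  have "r + (norm m)\<^sup>2 \<le> s + inner m p" if ps: "(p, s) \<in> E" for p s
  proof (rule ccontr)
    define l where "l = r + (norm m)\<^sup>2 - s - inner m p"
    \<comment> \<open>Moving from the minimiser towards \<open>(p, s)\<close> by a fraction \<open>t\<close> changes the value by
      \<open>t * (t * |p - m|^2 / 2 - l)\<close>, so this \<open>t\<close> is small enough to decrease it.\<close>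
    define t where "t = min 1 (l / ((norm (p - m))\<^sup>2 + 1))"
    assume "\<not> ?thesis"
    then have l: "0 < l" by (simp add: l_def)
    have den: "0 < (norm (p - m))\<^sup>2 + 1" by (smt (verit) zero_le_power2)
    have t: "0 < t" "t \<le> 1" using l den by (auto simp: t_def)
    have "t * ((norm (p - m))\<^sup>2 + 1) \<le> l"
      using den unfolding t_def by (simp flip: pos_le_divide_eq)
    then have small: "t * (norm (p - m))\<^sup>2 < l"
      using t by (simp add: algebra_simps)
    have "(1 - t) *\<^sub>R (m, r) + t *\<^sub>R (p, s) \<in> E"
      using \<open>convex E\<close> mE ps t unfolding r_def by (intro convexD) auto
    from I_le[OF this] have "I \<le> \<phi> ((1 - t) *\<^sub>R (m, r) + t *\<^sub>R (p, s))" .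
    also have "\<dots> = I + t * (t * (norm (p - m))\<^sup>2 / 2 - l)"
      by (simp add: \<phi>_def r_def l_def power2_norm_eq_inner inner_simps inner_commute field_simps)
    finally have "0 \<le> t * (norm (p - m))\<^sup>2 / 2 - l"
      using t by (simp add: zero_le_mult_iff)
    moreover have "0 \<le> t * (norm (p - m))\<^sup>2" using t by simp
    ultimately show False using small l by linarith
  qed
  with mE show thesis using that[of m r] by (simp add: r_def)
qed

lemma maximally_monotoneD:
  assumes "maximally_monotone A" "w \<in> A y" "v \<in> A x"
  shows "0 \<le> inner (x - y) (v - w)"
  using assms unfolding maximally_monotone_def monotone_operator_def gra_def by auto

lemma maximally_monotone_contains:
  assumes mm: "maximally_monotone A" and rel: "\<And>y w. w \<in> A y \<Longrightarrow> 0 \<le> inner (x - y) (v - w)"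
  shows "v \<in> A x"
proof (rule ccontr)
  assume nin: "v \<notin> A x"
  define B where "B y = (if y = x then insert v (A x) else A y)" for y
  have rel': "0 \<le> inner (y - x) (w - v)" if "w \<in> A y" for y w
    using rel[OF that] by (metis inner_minus_left inner_minus_right minus_diff_eq minus_minus)
  have "monotone_operator B"
    unfolding monotone_operator_def gra_def
    using rel rel' maximally_monotoneD[OF mm]
    by (auto simp: B_def split: if_splits)
  moreover have "gra A \<subset> gra B"
    using nin by (auto simp: gra_def B_def psubset_eq set_eq_iff)
  ultimately show False using mm unfolding maximally_monotone_def by blast
qed

text \<open>
  The set \<open>E\<close> below is the epigraph of the Fitzpatrick function
  \<open>F (x, v) = sup {\<langle>x, w\<rangle> + \<langle>y, v\<rangle> - \<langle>y, w\<rangle> | (y, w) \<in> G}\<close>, which maximality bounds below by \<open>\<langle>x, v\<rangle>\<close>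
  and which equals \<open>\<langle>y, w\<rangle>\<close> on the graph.  Minimise \<open>F\<close> plus half the squared norm, with minimiser
  \<open>(a, b)\<close>.  Tested at the points of \<open>G\<close>, the first-order condition says that \<open>(- b, - a)\<close> is
  monotonically related to all of \<open>G\<close>, even with the surplus \<open>|a + b|\<^sup>2\<close>.  So \<open>(- b, - a)\<close> lies in \<open>G\<close>
  by maximality, and testing it against itself gives \<open>a = - b\<close>.
\<close>

lemma minty_zero:
  fixes G :: "('a::{real_inner,complete_space} \<times> 'a) set"
  assumes mono: "\<And>x v y w. \<lbrakk>(x, v) \<in> G; (y, w) \<in> G\<rbrakk> \<Longrightarrow> 0 \<le> inner (x - y) (v - w)"
    and maximal: "\<And>x v. (\<And>y w. (y, w) \<in> G \<Longrightarrow> 0 \<le> inner (x - y) (v - w)) \<Longrightarrow> (x, v) \<in> G"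
  obtains a where "(a, - a) \<in> G"
proof -
  define E where "E = {((x, v), r) | x v r. \<forall>(y, w)\<in>G. inner x w + inner y v - inner y w \<le> (r::real)}"
  have E_eq: "E = (\<Inter>g\<in>G. {q. inner (fst (fst q)) (snd g) + inner (fst g) (snd (fst q))
      - inner (fst g) (snd g) \<le> snd q})"
    by (auto simp: E_def case_prod_beta)
  have "closed E"
    unfolding E_eq by (intro closed_INT ballI closed_Collect_le continuous_intros)
  moreover have "convex E"
    unfolding E_eq
  proof (intro convex_INT)
    fix g :: "'a \<times> 'a"
    have "convex {q :: ('a \<times> 'a) \<times> real. inner ((snd g, fst g), -1) q \<le> inner (fst g) (snd g)}"
      by (rule convex_halfspace_le)
    moreover have "{q :: ('a \<times> 'a) \<times> real. inner ((snd g, fst g), -1) q \<le> inner (fst g) (snd g)} =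
        {q. inner (fst (fst q)) (snd g) + inner (fst g) (snd (fst q)) - inner (fst g) (snd g) \<le> snd q}"
      by (auto simp: inner_prod_def inner_commute algebra_simps)
    ultimately show "convex {q. inner (fst (fst q)) (snd g) + inner (fst g) (snd (fst q))
        - inner (fst g) (snd g) \<le> snd q}" by simp
  qed
  moreover have graph_in_E: "((y, w), inner y w) \<in> E" if "(y, w) \<in> G" for y w
    using mono[OF that] by (auto simp: E_def inner_simps inner_commute algebra_simps)
  have "G \<noteq> {}" using maximal by blast
  with graph_in_E have "E \<noteq> {}" by fastforce
  moreover have above: "inner x v \<le> r" if xvr: "((x, v), r) \<in> E" for x v r
  proof (rule ccontr)
    assume "\<not> ?thesis"
    then have r: "r < inner x v" by simp
    have "0 < inner (x - y) (v - w)" if "(y, w) \<in> G" for y w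
    proof -
      have "inner x w + inner y v - inner y w \<le> r" using xvr that by (auto simp: E_def)
      then show ?thesis using r by (simp add: inner_diff_left inner_diff_right)
    qed
    moreover from this have "(x, v) \<in> G" by (intro maximal) (simp add: less_imp_le)
    ultimately show False by force
  qed
  have "0 \<le> r + (norm p)\<^sup>2 / 2" if "(p, r) \<in> E" for p r
  proof -
    obtain x v where p: "p = (x, v)" by fastforce
    have "0 \<le> (norm (x + v))\<^sup>2 / 2" by simp
    also have "\<dots> = inner x v + (norm p)\<^sup>2 / 2"
      by (simp add: p power2_norm_eq_inner inner_prod_def inner_simps inner_commute field_simps)
    finally show ?thesis using above that unfolding p by fastforce
  qed
  ultimately obtain m r where mr: "(m, r) \<in> E"
    "\<And>p s. (p, s) \<in> E \<Longrightarrow> r + (norm m)\<^sup>2 \<le> s + inner m p"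
    by (rule quadratic_minimiser[of E]) auto
  obtain a b where m: "m = (a, b)" by fastforce
  have key: "(norm (a + b))\<^sup>2 \<le> inner (- b - y) (- a - w)" if "(y, w) \<in> G" for y w
    using mr(2)[OF graph_in_E[OF that]] above[of a b r] mr(1)
    by (simp add: m power2_norm_eq_inner inner_prod_def inner_simps inner_commute)
  then have "0 \<le> inner (- b - y) (- a - w)" if "(y, w) \<in> G" for y w
    using that by (meson order_trans zero_le_power2)
  then have in_G: "(- b, - a) \<in> G" by (rule maximal)
  from key[OF this] have "a + b = 0" by simp
  then have "- b = a" by (simp add: add_eq_0_iff)
  with in_G show thesis using that[of a] by simp
qed

text \<open>
  The general case of Minty's theorem: \<open>A\<close> is transformed affinely into the operator \<open>c A - x\<close>, whose
  graph inherits monotonicity and maximality.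
\<close>

lemma minty:
  fixes A :: "'a::{real_inner,complete_space} \<Rightarrow> 'a set"
  assumes mm: "maximally_monotone A" and "0 < c"
  obtains p where "(x - p) /\<^sub>R c \<in> A p"
proof -
  define G where "G = {(y, w). (w + x) /\<^sub>R c \<in> A y}"
  obtain a where "(a, - a) \<in> G"
  proof (rule minty_zero[of G])
    fix y w y' w' assume "(y, w) \<in> G" "(y', w') \<in> G"
    then have "0 \<le> inner (y - y') ((w + x) /\<^sub>R c - (w' + x) /\<^sub>R c)"
      unfolding G_def using mm by (auto intro: maximally_monotoneD)
    also have "(w + x) /\<^sub>R c - (w' + x) /\<^sub>R c = (w - w') /\<^sub>R c"
      by (simp add: algebra_simps)
    finally show "0 \<le> inner (y - y') (w - w')"
      using \<open>0 < c\<close> by (simp add: zero_le_divide_iff zero_le_mult_iff)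
  next
    fix y w assume rel: "\<And>y' w'. (y', w') \<in> G \<Longrightarrow> 0 \<le> inner (y - y') (w - w')"
    have "(w + x) /\<^sub>R c \<in> A y"
    proof (rule maximally_monotone_contains[OF mm])
      fix y' w' assume "w' \<in> A y'"
      then have "(y', c *\<^sub>R w' - x) \<in> G" using \<open>0 < c\<close> by (simp add: G_def)
      from rel[OF this] have "0 \<le> inner (y - y') (w + x - c *\<^sub>R w')"
        by (simp add: algebra_simps)
      also have "w + x - c *\<^sub>R w' = c *\<^sub>R ((w + x) /\<^sub>R c - w')"
        using \<open>0 < c\<close> by (simp add: algebra_simps)
      finally show "0 \<le> inner (y - y') ((w + x) /\<^sub>R c - w')"
        using \<open>0 < c\<close> by (simp add: zero_le_mult_iff)
    qed
    then show "(y, w) \<in> G" by (simp add: G_def)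
  qed (use that in auto)
  then show thesis using that[of a] by (simp add: G_def)
qed

section \<open>Resolvents and the projection onto the zeros\<close>

lemma resolvent_graph:
  fixes A :: "'a::{real_inner,complete_space} \<Rightarrow> 'a set"
  assumes mm: "maximally_monotone A" and c: "0 < c"
  shows "(x - resolvent c A x) /\<^sub>R c \<in> A (resolvent c A x)"
proof -
  have iff: "p \<in> inverse_operator (id_plus_scaled c A) x \<longleftrightarrow> (x - p) /\<^sub>R c \<in> A p" for p
  proof
    assume "(x - p) /\<^sub>R c \<in> A p"
    moreover have "x = p + c *\<^sub>R ((x - p) /\<^sub>R c)" using c by simp
    ultimately show "p \<in> inverse_operator (id_plus_scaled c A) x"
      unfolding inverse_operator_def id_plus_scaled_def by blast
  qed (use c in \<open>auto simp: inverse_operator_def id_plus_scaled_def\<close>)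
  obtain p where p: "(x - p) /\<^sub>R c \<in> A p" using minty[OF mm c] .
  have "p' = p" if "(x - p') /\<^sub>R c \<in> A p'" for p'
  proof -
    have "0 \<le> inner (p' - p) ((x - p') /\<^sub>R c - (x - p) /\<^sub>R c)"
      by (rule maximally_monotoneD[OF mm p that])
    also have "(x - p') /\<^sub>R c - (x - p) /\<^sub>R c = - ((p' - p) /\<^sub>R c)"
      by (simp add: algebra_simps)
    also have "inner (p' - p) (- ((p' - p) /\<^sub>R c)) = - ((norm (p' - p))\<^sup>2 / c)"
      by (simp add: power2_norm_eq_inner divide_inverse)
    finally have "(norm (p' - p))\<^sup>2 \<le> 0" using c by (simp add: divide_le_0_iff)
    then show ?thesis by simp
  qed
  with p have "resolvent c A x = p"
    unfolding resolvent_def iff by (metis (no_types, lifting) the_equality)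
  with p show ?thesis by simp
qed

lemma resolvent_zer_inner:
  fixes A :: "'a::{real_inner,complete_space} \<Rightarrow> 'a set"
  assumes "maximally_monotone A" "0 < c" "z \<in> zer A"
  shows "0 \<le> inner (x - resolvent c A x) (resolvent c A x - z)"
proof -
  have "0 \<le> inner (resolvent c A x - z) ((x - resolvent c A x) /\<^sub>R c - 0)"
    using assms by (intro maximally_monotoneD[OF assms(1)] resolvent_graph) (auto simp: zer_def)
  then show ?thesis using \<open>0 < c\<close> by (simp add: inner_commute zero_le_mult_iff)
qed

text \<open>
  The resolvents \<open>J\<^sub>t u\<close> converge to the projection of \<open>u\<close> onto the zeros as \<open>t\<close> grows.  For \<open>s \<le> t\<close>,
  monotonicity applied to the two points gives
  \<open>|J\<^sub>t u - J\<^sub>s u|\<^sup>2 \<le> |u - J\<^sub>t u|\<^sup>2 - |u - J\<^sub>s u|\<^sup>2\<close>, and \<open>|u - J\<^sub>t u|\<close> is at most the distance from \<open>u\<close> to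
  any zero; so the path is Cauchy.  Since \<open>(u - J\<^sub>t u) / t\<close> tends to \<open>0\<close>, its limit is a zero of \<open>A\<close>,
  and passing to the limit in \<open>\<langle>u - J\<^sub>t u, J\<^sub>t u - y\<rangle> \<ge> 0\<close> yields the obtuse-angle characterisation of the
  projection.  In particular, the description that defines the projector is proper.
\<close>

lemma resolvent_limit:
  fixes A :: "'a::{real_inner,complete_space} \<Rightarrow> 'a set"
  assumes mm: "maximally_monotone A" and ne: "zer A \<noteq> {}"
  obtains z where "z \<in> zer A" "(\<lambda>n. resolvent (real (Suc n)) A u) \<longlonglongrightarrow> z"
    "projector (zer A) u = z"
proof -
  define J where "J n = resolvent (real (Suc n)) A u" for n
  define N where "N n = (norm (u - J n))\<^sup>2" for n
  have graph: "(u - J n) /\<^sub>R real (Suc n) \<in> A (J n)" for n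
    unfolding J_def by (rule resolvent_graph[OF mm]) simp
  have zer_inner: "0 \<le> inner (u - J n) (J n - y)" if "y \<in> zer A" for n y
    unfolding J_def using that by (intro resolvent_zer_inner[OF mm]) auto
  have gap: "(dist (J i) (J j))\<^sup>2 \<le> N j - N i" if "i \<le> j" for i j
  proof -
    define a b where "a = u - J j" and "b = u - J i"
    define s t where "s = real (Suc i)" and "t = real (Suc j)"
    have st: "0 < s" "s \<le> t" using that by (auto simp: s_def t_def)
    have "0 \<le> inner (b - a) (a /\<^sub>R t - b /\<^sub>R s)"
      using maximally_monotoneD[OF mm graph[of i] graph[of j]]
      by (simp add: a_def b_def s_def t_def)
    then have "0 \<le> (s * t) * inner (b - a) (a /\<^sub>R t - b /\<^sub>R s)" using st by simp
    also have "\<dots> = s * inner (b - a) a - t * inner (b - a) b"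
      using st by (simp add: inner_simps field_simps)
    also have "\<dots> = - (s * (norm (b - a))\<^sup>2) - (t - s) * inner (b - a) b"
      by (simp add: power2_norm_eq_inner inner_simps inner_commute algebra_simps)
    finally have le: "s * (norm (b - a))\<^sup>2 + (t - s) * inner (b - a) b \<le> 0" by linarith
    have "inner (b - a) b \<le> 0"
    proof (cases "s = t")
      case True
      then have "i = j" by (simp add: s_def t_def)
      then show ?thesis by (simp add: a_def b_def)
    next
      case False
      moreover have "0 \<le> s * (norm (b - a))\<^sup>2" using st by simp
      ultimately have "0 < t - s" "(t - s) * inner (b - a) b \<le> 0" using st le by linarith+
      then show ?thesis by (simp add: mult_le_0_iff)
    qed
    then have "(norm (b - a))\<^sup>2 \<le> (norm a)\<^sup>2 - (norm b)\<^sup>2"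
      by (simp add: power2_norm_eq_inner inner_simps inner_commute)
    then show ?thesis by (simp add: a_def b_def N_def dist_norm norm_minus_commute)
  qed
  obtain y0 where y0: "y0 \<in> zer A" using ne by blast
  have "N n \<le> (norm (u - y0))\<^sup>2" for n
  proof -
    have "(norm (u - y0))\<^sup>2 = N n + (norm (J n - y0))\<^sup>2 + 2 * inner (u - J n) (J n - y0)"
      by (simp add: N_def power2_norm_eq_inner inner_simps inner_commute algebra_simps)
    then show ?thesis using zer_inner[OF y0, of n] by (smt (verit) zero_le_power2)
  qed
  moreover have "N i \<le> N j" if "i \<le> j" for i j
    using gap[OF that] by (smt (verit) zero_le_power2)
  ultimately have "convergent N"
    using incseq_convergent[of N] by (metis convergentI incseq_def)
  then have "Cauchy N" by (rule convergent_Cauchy)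
  have "Cauchy J"
  proof (rule metric_CauchyI)
    fix e :: real assume "0 < e"
    then obtain M where M: "\<And>i j. M \<le> i \<Longrightarrow> M \<le> j \<Longrightarrow> dist (N i) (N j) < e\<^sup>2"
      using metric_CauchyD[OF \<open>Cauchy N\<close>, of "e\<^sup>2"] by auto
    have *: "dist (J i) (J j) < e" if "M \<le> i" "i \<le> j" for i j
    proof -
      have "(dist (J i) (J j))\<^sup>2 < e\<^sup>2"
        using gap[OF that(2)] M[of i j] that by (auto simp: dist_real_def)
      then show ?thesis using \<open>0 < e\<close> by (simp add: power_less_imp_less_base)
    qed
    have "dist (J i) (J j) < e" if "M \<le> i" "M \<le> j" for i j
      using *[of i j] *[of j i] that by (cases "i \<le> j") (auto simp: dist_commute)
    then show "\<exists>M. \<forall>m\<ge>M. \<forall>n\<ge>M. dist (J m) (J n) < e" by blast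
  qed
  then obtain z where z: "J \<longlonglongrightarrow> z" using Cauchy_convergent_iff convergent_def by blast
  have "(\<lambda>n. inverse (real (Suc n)) *\<^sub>R (u - J n)) \<longlonglongrightarrow> 0 *\<^sub>R (u - z)"
    by (intro tendsto_intros z LIMSEQ_inverse_real_of_nat)
  then have v: "(\<lambda>n. (u - J n) /\<^sub>R real (Suc n)) \<longlonglongrightarrow> 0" by simp
  have "0 \<in> A z"
  proof (rule maximally_monotone_contains[OF mm])
    fix y w assume w: "w \<in> A y"
    have "(\<lambda>n. inner (J n - y) ((u - J n) /\<^sub>R real (Suc n) - w)) \<longlonglongrightarrow> inner (z - y) (0 - w)"
      by (intro tendsto_intros z v)
    then show "0 \<le> inner (z - y) (0 - w)"
      by (rule LIMSEQ_le_const) (use maximally_monotoneD[OF mm w graph] in auto)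
  qed
  then have z_zer: "z \<in> zer A" by (simp add: zer_def)
  have obtuse: "0 \<le> inner (u - z) (z - y)" if "y \<in> zer A" for y
  proof -
    have "(\<lambda>n. inner (u - J n) (J n - y)) \<longlonglongrightarrow> inner (u - z) (z - y)"
      by (intro tendsto_intros z)
    then show ?thesis by (rule LIMSEQ_le_const) (use zer_inner[OF that] in auto)
  qed
  have pyth: "(norm (u - z))\<^sup>2 + (norm (z - y))\<^sup>2 \<le> (norm (u - y))\<^sup>2" if "y \<in> zer A" for y
    using obtuse[OF that]
    by (simp add: power2_norm_eq_inner inner_simps inner_commute algebra_simps)
  have "projector (zer A) u = z"
    unfolding projector_def
  proof (rule the_equality)
    have "norm (u - z) \<le> norm (u - y)" if "y \<in> zer A" for y
      using pyth[OF that] by (smt (verit) norm_ge_zero power2_le_imp_le zero_le_power2)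
    then show "z \<in> zer A \<and> (\<forall>y\<in>zer A. norm (u - z) \<le> norm (u - y))" using z_zer by blast
  next
    fix p assume p: "p \<in> zer A \<and> (\<forall>y\<in>zer A. norm (u - p) \<le> norm (u - y))"
    then have "(norm (u - p))\<^sup>2 \<le> (norm (u - z))\<^sup>2" using z_zer by (simp add: power_mono)
    moreover have "(norm (u - z))\<^sup>2 + (norm (z - p))\<^sup>2 \<le> (norm (u - p))\<^sup>2"
      using pyth p by blast
    ultimately have "(norm (z - p))\<^sup>2 \<le> 0" by linarith
    then show "p = z" by simp
  qed
  with z z_zer show thesis using that by (simp add: J_def[abs_def])
qed

section \<open>Two convergence criteria for real sequences\<close>

lemma contraction_recursion_tendsto_zero:
  fixes r \<mu> \<epsilon> :: "nat \<Rightarrow> real"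
  assumes nonneg: "\<And>k. 0 \<le> r k" "\<And>k. 0 \<le> \<epsilon> k"
    and \<mu>: "\<And>k. 0 \<le> \<mu> k" "\<And>k. \<mu> k \<le> 1"
    and rec: "\<forall>\<^sub>F k in sequentially. r (Suc k) \<le> (1 - \<mu> k) * r k + \<epsilon> k"
    and div: "filterlim (\<lambda>n. \<Sum>k<n. \<mu> k) at_top sequentially"
    and sum: "summable \<epsilon>"
  shows "r \<longlonglongrightarrow> 0"
proof (rule LIMSEQ_I)
  fix e :: real assume e: "0 < e"
  obtain K where K: "\<And>k. K \<le> k \<Longrightarrow> r (Suc k) \<le> (1 - \<mu> k) * r k + \<epsilon> k"
    using rec unfolding eventually_sequentially by blast
  obtain M where M: "\<And>m n. M \<le> m \<Longrightarrow> norm (sum \<epsilon> {m..<n}) < e / 2"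
    using sum e unfolding summable_Cauchy by (meson half_gt_zero)
  define n where "n = max K M"
  \<comment> \<open>Uses \<open>1 - \<mu> \<le> exp (- \<mu>)\<close>: the divergent sum kills the initial value, and the errors
    beyond \<open>n\<close> add up to less than \<open>e / 2\<close>.\<close>
  have unrolled: "r (n + j) \<le> exp (- (\<Sum>k=n..<n+j. \<mu> k)) * r n + (\<Sum>k=n..<n+j. \<epsilon> k)" for j
  proof (induction j)
    case (Suc j)
    have "r (n + Suc j) \<le> (1 - \<mu> (n + j)) * r (n + j) + \<epsilon> (n + j)"
      using K[of "n + j"] by (simp add: n_def)
    also have "(1 - \<mu> (n + j)) * r (n + j) \<le>
        (1 - \<mu> (n + j)) * (exp (- (\<Sum>k=n..<n+j. \<mu> k)) * r n + (\<Sum>k=n..<n+j. \<epsilon> k))"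
      using Suc.IH \<mu>(2)[of "n + j"] by (intro mult_left_mono) auto
    also have "\<dots> \<le> exp (- \<mu> (n + j)) * (exp (- (\<Sum>k=n..<n+j. \<mu> k)) * r n) + 1 * (\<Sum>k=n..<n+j. \<epsilon> k)"
      unfolding distrib_left
      using \<mu>[of "n + j"] nonneg exp_ge_add_one_self[of "- \<mu> (n + j)"]
      by (intro add_mono mult_right_mono) (auto intro!: sum_nonneg)
    finally show ?case by (simp add: exp_diff exp_minus exp_add field_simps)
  qed simp
  have "filterlim (\<lambda>m. (\<Sum>k<m. \<mu> k) + - (\<Sum>k<n. \<mu> k)) at_top sequentially"
    using filterlim_tendsto_add_at_top[OF tendsto_const[of "- (\<Sum>k<n. \<mu> k)"] div]
    by (simp add: add.commute)
  then have "((\<lambda>m. exp (- ((\<Sum>k<m. \<mu> k) + - (\<Sum>k<n. \<mu> k))) * r n) \<longlongrightarrow> 0 * r n) sequentially"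
    by (intro tendsto_mult tendsto_const filterlim_compose[OF exp_at_bot]
        filterlim_compose[OF filterlim_uminus_at_bot_at_top])
  then have "\<forall>\<^sub>F m in sequentially. exp (- ((\<Sum>k<m. \<mu> k) + - (\<Sum>k<n. \<mu> k))) * r n < e / 2"
    using e by (intro order_tendstoD(2)[where y = 0]) auto
  then obtain L where L: "\<And>m. L \<le> m \<Longrightarrow> exp (- ((\<Sum>k<m. \<mu> k) + - (\<Sum>k<n. \<mu> k))) * r n < e / 2"
    unfolding eventually_sequentially by blast
  have "norm (r m - 0) < e" if m: "max L n \<le> m" for m
  proof -
    obtain j where j: "m = n + j" using m le_Suc_ex by auto
    have "{..<m} = {..<n} \<union> {n..<m}" using j by auto
    then have "(\<Sum>k<m. \<mu> k) = (\<Sum>k<n. \<mu> k) + (\<Sum>k=n..<m. \<mu> k)"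
      by (simp add: sum.union_disjoint ivl_disj_int)
    with L[of m] m have "exp (- (\<Sum>k=n..<m. \<mu> k)) * r n < e / 2" by simp
    moreover have "(\<Sum>k=n..<m. \<epsilon> k) < e / 2"
      using M[of n m] by (auto simp: n_def)
    ultimately show ?thesis using unrolled[of j] nonneg(1)[of m] by (simp add: j)
  qed
  then show "\<exists>no. \<forall>n\<ge>no. norm (r n - 0) < e" by blast
qed

text \<open>
  This replaces an extraction of subsequences: at every late index, either the term \<open>b\<close> of the
  contractive recursion is harmless, or \<open>s\<close> drops by a fixed amount \<open>\<rho>\<close>.  As \<open>s\<close> is bounded, a drop by
  \<open>\<rho>\<close> is at least as good as a contraction by a fixed multiple of \<open>t\<close>.  Either way the excess of \<open>s\<close>
  over a given \<open>\<eta>\<close> obeys one contractive recursion with a divergent sum of rates.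
\<close>

lemma contraction_or_drop_tendsto_zero:
  fixes s t b \<epsilon> :: "nat \<Rightarrow> real"
  assumes s: "\<And>k. 0 \<le> s k" "\<And>k. s k \<le> M"
    and t: "\<And>k. 0 \<le> t k" "\<And>k. t k \<le> 1"
    and \<epsilon>: "\<And>k. 0 \<le> \<epsilon> k" "summable \<epsilon>"
    and rec: "\<And>k. s (Suc k) \<le> (1 - t k) * s k + t k * b k + \<epsilon> k"
    and div: "filterlim (\<lambda>n. \<Sum>k<n. t k) at_top sequentially"
    and drop: "\<And>\<eta>. 0 < \<eta> \<Longrightarrow> \<exists>\<rho>>0. \<forall>\<^sub>F k in sequentially. b k \<le> \<eta> \<or> s (Suc k) \<le> s k - \<rho>"
  shows "s \<longlonglongrightarrow> 0"
proof (rule LIMSEQ_I)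
  fix e :: real assume e: "0 < e"
  define \<eta> where "\<eta> = e / 2"
  have \<eta>: "0 < \<eta>" using e by (simp add: \<eta>_def)
  obtain \<rho> where \<rho>: "0 < \<rho>" "\<forall>\<^sub>F k in sequentially. b k \<le> \<eta> \<or> s (Suc k) \<le> s k - \<rho>"
    using drop[OF \<eta>] by blast
  define \<mu> where "\<mu> = \<rho> / (max M 0 + \<rho>)"
  define r where "r k = max (s k - \<eta>) 0" for k
  have den: "0 < max M 0 + \<rho>" using \<rho>(1) by linarith
  have \<mu>: "0 < \<mu>" "\<mu> \<le> 1" using \<rho>(1) den by (auto simp: \<mu>_def divide_le_eq)
  have "r \<longlonglongrightarrow> 0"
  proof (rule contraction_recursion_tendsto_zero[where \<mu> = "\<lambda>k. \<mu> * t k" and \<epsilon> = \<epsilon>])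
    show "\<forall>\<^sub>F k in sequentially. r (Suc k) \<le> (1 - \<mu> * t k) * r k + \<epsilon> k"
      using \<rho>(2)
    proof eventually_elim
      case (elim k)
      have r0: "0 \<le> r k" by (simp add: r_def)
      have mt: "\<mu> * t k \<le> t k" "\<mu> * t k \<le> \<mu>" "0 \<le> \<mu> * t k"
        using \<mu> t[of k] by (auto intro: mult_left_le mult_right_le_one_le mult_left_le_one_le)
      have rhs: "0 \<le> (1 - \<mu> * t k) * r k" using mt \<mu> r0 by (intro mult_nonneg_nonneg) auto
      have "s (Suc k) - \<eta> \<le> (1 - \<mu> * t k) * r k + \<epsilon> k"
        using elim
      proof
        assume "b k \<le> \<eta>"
        then have "t k * b k \<le> t k * \<eta>" using t by (intro mult_left_mono) auto
        with rec[of k] have "s (Suc k) - \<eta> \<le> (1 - t k) * (s k - \<eta>) + \<epsilon> k"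
          by (simp add: algebra_simps)
        also have "(1 - t k) * (s k - \<eta>) \<le> (1 - t k) * r k"
          using t by (intro mult_left_mono) (auto simp: r_def)
        also have "(1 - t k) * r k \<le> (1 - \<mu> * t k) * r k"
          using mt r0 by (intro mult_right_mono) auto
        finally show ?thesis by simp
      next
        assume *: "s (Suc k) \<le> s k - \<rho>"
        have "r k \<le> max M 0 + \<rho>" using s(2)[of k] \<eta> \<rho>(1) by (auto simp: r_def)
        then have "\<mu> * r k \<le> \<mu> * (max M 0 + \<rho>)" using \<mu> by (intro mult_left_mono) auto
        also have "\<dots> = \<rho>" using den by (simp add: \<mu>_def)
        finally have "\<mu> * t k * r k \<le> \<rho>"
          using mult_right_mono[OF mt(2) r0] by linarith
        moreover have "s k - \<eta> \<le> r k" by (simp add: r_def)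
        ultimately show ?thesis using * \<epsilon>(1)[of k] by (simp add: algebra_simps)
      qed
      with rhs \<epsilon>(1)[of k] show ?case by (auto simp: r_def)
    qed
    show "filterlim (\<lambda>n. \<Sum>k<n. \<mu> * t k) at_top sequentially"
      unfolding sum_distrib_left[symmetric]
      by (rule filterlim_tendsto_pos_mult_at_top[OF tendsto_const \<mu>(1) div])
    show "\<mu> * t k \<le> 1" for k using \<mu> t[of k] by (simp add: mult_le_one)
  qed (use \<mu> t \<epsilon> in \<open>auto simp: r_def\<close>)
  then have "\<forall>\<^sub>F k in sequentially. r k < \<eta>" using \<eta> by (rule order_tendstoD)
  then have "\<forall>\<^sub>F k in sequentially. norm (s k - 0) < e"
  proof eventually_elim
    case (elim k)
    then show ?case using s(1)[of k] e unfolding r_def \<eta>_def real_norm_def by linarith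
  qed
  then show "\<exists>no. \<forall>n\<ge>no. norm (s n - 0) < e" unfolding eventually_sequentially .
qed

section \<open>Estimates for reflected resolvents\<close>

lemma norm_combination_le:
  fixes p q :: "'a::real_normed_vector"
  assumes "norm q \<le> norm p"
  shows "norm (a *\<^sub>R p + b *\<^sub>R q) \<le> (\<bar>a\<bar> + \<bar>b\<bar>) * norm p"
proof -
  have "norm (a *\<^sub>R p + b *\<^sub>R q) \<le> \<bar>a\<bar> * norm p + \<bar>b\<bar> * norm q"
    using norm_triangle_ineq[of "a *\<^sub>R p" "b *\<^sub>R q"] by simp
  also have "\<dots> \<le> \<bar>a\<bar> * norm p + \<bar>b\<bar> * norm p"
    using assms by (intro add_left_mono mult_left_mono) auto
  finally show ?thesis by (simp add: algebra_simps)
qed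

text \<open>
  From the identity \<open>|a p + b q|\<^sup>2 = (a + b) (a |p|\<^sup>2 + b |q|\<^sup>2) - a b |p - q|\<^sup>2\<close>.
\<close>

lemma norm_combination_gap:
  fixes p q :: "'a::real_inner"
  assumes qp: "norm q \<le> norm p" and \<kappa>: "0 \<le> \<kappa>" "\<kappa> \<le> a" "\<kappa> \<le> b" and ab: "a + b \<le> 1"
  shows "(norm (a *\<^sub>R p + b *\<^sub>R q))\<^sup>2 \<le> (norm p)\<^sup>2 - \<kappa>\<^sup>2 * (norm (p - q))\<^sup>2"
proof -
  have "(norm (a *\<^sub>R p + b *\<^sub>R q))\<^sup>2 =
      (a + b) * (a * (norm p)\<^sup>2 + b * (norm q)\<^sup>2) - (a * b) * (norm (p - q))\<^sup>2"
    by (simp add: power2_norm_eq_inner inner_simps inner_commute algebra_simps)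
  also have "\<dots> \<le> (norm p)\<^sup>2 - \<kappa>\<^sup>2 * (norm (p - q))\<^sup>2"
  proof (rule diff_mono)
    have "(norm q)\<^sup>2 \<le> (norm p)\<^sup>2" using qp by (simp add: power_mono)
    then have "(a + b) * (a * (norm p)\<^sup>2 + b * (norm q)\<^sup>2) \<le>
        (a + b) * (a * (norm p)\<^sup>2 + b * (norm p)\<^sup>2)"
      using \<kappa> by (intro mult_left_mono add_left_mono) auto
    also have "\<dots> = (a + b)\<^sup>2 * (norm p)\<^sup>2" by (simp add: power2_eq_square algebra_simps)
    also have "\<dots> \<le> 1 * (norm p)\<^sup>2" using \<kappa> ab by (intro mult_right_mono power_le_one) auto
    finally show "(a + b) * (a * (norm p)\<^sup>2 + b * (norm q)\<^sup>2) \<le> (norm p)\<^sup>2" by simp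
    have "\<kappa>\<^sup>2 \<le> a * b" using \<kappa> unfolding power2_eq_square by (intro mult_mono) auto
    then show "\<kappa>\<^sup>2 * (norm (p - q))\<^sup>2 \<le> a * b * (norm (p - q))\<^sup>2" by (rule mult_right_mono) simp
  qed
  finally show ?thesis .
qed

lemma resolvent_reflection_le:
  fixes A :: "'a::{real_inner,complete_space} \<Rightarrow> 'a set"
  assumes "maximally_monotone A" "0 < c" "z \<in> zer A"
  shows "norm (2 *\<^sub>R resolvent c A x - x - z) \<le> norm (x - z)"
proof (rule power2_le_imp_le)
  show "(norm (2 *\<^sub>R resolvent c A x - x - z))\<^sup>2 \<le> (norm (x - z))\<^sup>2"
    using resolvent_zer_inner[OF assms, of x]
    by (simp add: power2_norm_eq_inner inner_simps inner_commute algebra_simps)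
qed simp

lemma resolvent_dist_le:
  fixes A :: "'a::{real_inner,complete_space} \<Rightarrow> 'a set"
  assumes "maximally_monotone A" "0 < c" "z \<in> zer A"
  shows "norm (resolvent c A x - z) \<le> norm (x - z)"
proof -
  have "resolvent c A x - z = (1/2) *\<^sub>R (x - z) + (1/2) *\<^sub>R (2 *\<^sub>R resolvent c A x - x - z)"
    by (simp add: algebra_simps flip: scaleR_add_left)
  then show ?thesis
    using norm_combination_le[OF resolvent_reflection_le[OF assms, of x], of "1/2" "1/2"] by simp
qed

text \<open>
  A quantitative substitute for demiclosedness.  Let \<open>w = J\<^sub>l u\<close> with \<open>l\<close> so large that \<open>w\<close> is close to
  \<open>z\<close>, and \<open>y = J\<^sub>c x\<close>.  Monotonicity between \<open>w\<close> and \<open>y\<close> reads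
  \<open>\<langle>u - w, y - w\<rangle> \<le> (l / c) \<langle>x - y, y - w\<rangle>\<close>, and for this fixed \<open>l\<close> the right-hand side is small as
  soon as \<open>x - y\<close> is.  The bound \<open>\<rho>\<close> is uniform in \<open>c \<ge> c0\<close> and in bounded \<open>x\<close>.
\<close>

lemma resolvent_almost_fixed_angle:
  fixes A :: "'a::{real_inner,complete_space} \<Rightarrow> 'a set"
  assumes mm: "maximally_monotone A" and z: "z \<in> zer A"
    and lim: "(\<lambda>n. resolvent (real (Suc n)) A u) \<longlonglongrightarrow> z"
    and pos: "0 < c0" "0 \<le> B" "0 < \<eta>"
  obtains \<rho> where "0 < \<rho>"
    "\<And>c x. \<lbrakk>c0 \<le> c; norm (x - z) \<le> B; norm (x - resolvent c A x) \<le> \<rho>\<rbrakk>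
      \<Longrightarrow> inner (u - z) (resolvent c A x - z) \<le> \<eta>"
proof -
  define D where "D = norm (u - z) + 1 + B"
  have D: "0 < D" using pos norm_ge_zero[of "u - z"] unfolding D_def by linarith
  have "\<forall>\<^sub>F n in sequentially. dist (resolvent (real (Suc n)) A u) z < min 1 (\<eta> / (2 * D))"
    using D pos by (intro tendstoD[OF lim]) auto
  then obtain n where n: "dist (resolvent (real (Suc n)) A u) z < min 1 (\<eta> / (2 * D))"
    using eventually_happens by force
  define l w where "l = real (Suc n)" and "w = resolvent l A u"
  have l: "0 < l" by (simp add: l_def)
  have wz: "norm (w - z) < 1" "norm (w - z) * D < \<eta> / 2"
    using n D by (auto simp: w_def l_def dist_norm field_simps)
  define \<rho> where "\<rho> = \<eta> * c0 / (2 * l * (B + 1))"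
  have \<rho>: "0 < \<rho>" using pos l by (simp add: \<rho>_def)
  show thesis
  proof (rule that[of \<rho>])
    show "0 < \<rho>" by (rule \<rho>)
  next
    fix c x assume c: "c0 \<le> c" and xB: "norm (x - z) \<le> B" and near: "norm (x - resolvent c A x) \<le> \<rho>"
    define y where "y = resolvent c A x"
    have c0: "0 < c" using c pos by simp
    have yB: "norm (y - z) \<le> B"
      using resolvent_dist_le[OF mm c0 z, of x] xB by (simp add: y_def)
    have "0 \<le> inner (w - y) ((u - w) /\<^sub>R l - (x - y) /\<^sub>R c)"
      using resolvent_graph[OF mm] l c0 unfolding w_def y_def
      by (intro maximally_monotoneD[OF mm]) auto
    then have "0 \<le> l * inner (w - y) ((u - w) /\<^sub>R l - (x - y) /\<^sub>R c)" using l by simp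
    also have "\<dots> = l / c * inner (x - y) (y - w) - inner (u - w) (y - w)"
    proof -
      have "inner (w - y) (x - y) = - inner (x - y) (y - w)" "inner (w - y) (u - w) = - inner (u - w) (y - w)"
        by (simp_all add: inner_commute flip: inner_minus_right)
      then show ?thesis
        unfolding inner_diff_right[of "w - y" "(u - w) /\<^sub>R l" "(x - y) /\<^sub>R c"] inner_scaleR_right
        using l by (simp add: field_simps)
    qed
    finally have "inner (u - w) (y - w) \<le> l / c * inner (x - y) (y - w)" by simp
    also have "\<dots> \<le> l / c * (\<rho> * (B + 1))"
    proof (rule mult_left_mono)
      have "norm (y - w) \<le> B + 1"
        using norm_triangle_ineq4[of "y - z" "w - z"] yB wz by simp
      then have "norm (x - y) * norm (y - w) \<le> \<rho> * (B + 1)"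
        using near \<rho> by (intro mult_mono) (auto simp: y_def)
      then show "inner (x - y) (y - w) \<le> \<rho> * (B + 1)"
        using norm_cauchy_schwarz[of "x - y" "y - w"] by linarith
    qed (use l c0 in simp)
    also have "\<dots> \<le> l / c0 * (\<rho> * (B + 1))"
      using c pos l \<rho> by (intro mult_right_mono frac_le) auto
    also have "\<dots> = \<eta> / 2" using pos l by (simp add: \<rho>_def)
    finally have 1: "inner (u - w) (y - w) \<le> \<eta> / 2" .
    have "inner (u - w) (w - z) + inner (w - z) (y - z) \<le>
        norm (u - w) * norm (w - z) + norm (w - z) * norm (y - z)"
      by (intro add_mono norm_cauchy_schwarz)
    also have "\<dots> = norm (w - z) * (norm (u - w) + norm (y - z))" by (simp add: algebra_simps)
    also have "\<dots> \<le> norm (w - z) * D"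
    proof (rule mult_left_mono)
      have "norm (u - w) \<le> norm (u - z) + 1"
        using norm_triangle_ineq4[of "u - z" "w - z"] wz by simp
      then show "norm (u - w) + norm (y - z) \<le> D" using yB by (simp add: D_def)
    qed simp
    finally have 2: "inner (u - w) (w - z) + inner (w - z) (y - z) \<le> \<eta> / 2" using wz by simp
    have "inner (u - z) (y - z) =
        inner (u - w) (y - w) + (inner (u - w) (w - z) + inner (w - z) (y - z))"
      by (simp add: inner_simps)
    also have "\<dots> \<le> \<eta>" using 1 2 by simp
    finally show "inner (u - z) (resolvent c A x - z) \<le> \<eta>" by (simp add: y_def)
  qed
qed

section \<open>Convergence of the perturbed iteration\<close>

text \<open>
  Write \<open>s k = |x k - z|\<^sup>2\<close>.  The errors may be of size \<open>o(t k)\<close> plus a summable part; the same is asked of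
  the negative part of \<open>\<alpha>\<close>, since the angle \<open>\<langle>u - z, x (k + 1) - z\<rangle>\<close> can only be controlled from above.
  Two estimates of \<open>s (k + 1)\<close> are combined: a contraction by \<open>1 - t k\<close> up to \<open>t k\<close> times the positive part
  of that angle, and, as \<open>a\<close> and \<open>b\<close> stay above \<open>\<kappa>\<close>, a decrease proportional to \<open>|x k - J (x k)|\<^sup>2\<close> up to
  \<open>o(1)\<close>.  If \<open>x k\<close> is nearly fixed by the resolvent then the angle is small; otherwise \<open>s\<close> drops.
\<close>

lemma perturbed_resolvent_iteration:
  fixes A :: "'a::{real_inner,complete_space} \<Rightarrow> 'a set"
    and x g :: "nat \<Rightarrow> 'a" and c \<alpha> a b \<tau> \<sigma> :: "nat \<Rightarrow> real"
  defines "t \<equiv> \<lambda>k. 1 - (\<bar>a k\<bar> + \<bar>b k\<bar>)\<^sup>2"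
  assumes mm: "maximally_monotone A" and z: "z \<in> zer A"
    and lim: "(\<lambda>n. resolvent (real (Suc n)) A u) \<longlonglongrightarrow> z"
    and c: "\<And>k. 0 < c k" "0 < c0" "\<forall>\<^sub>F k in sequentially. c0 \<le> c k"
    and rec: "\<And>k. x (Suc k) - z = \<alpha> k *\<^sub>R (u - z) + a k *\<^sub>R (x k - z)
        + b k *\<^sub>R (2 *\<^sub>R resolvent (c k) A (x k) - x k - z) + g k"
    and budget: "\<And>k. \<bar>\<alpha> k\<bar> + \<bar>a k\<bar> + \<bar>b k\<bar> \<le> 1"
    and \<alpha>0: "\<alpha> \<longlonglongrightarrow> 0"
    and \<kappa>: "0 < \<kappa>" "\<forall>\<^sub>F k in sequentially. \<kappa> \<le> a k" "\<forall>\<^sub>F k in sequentially. \<kappa> \<le> b k"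
    and ab1: "(\<lambda>k. a k + b k) \<longlonglongrightarrow> 1"
    and g: "\<And>k. norm (g k) \<le> t k * \<tau> k + \<sigma> k"
    and \<alpha>neg: "\<And>k. - \<alpha> k \<le> t k * \<tau> k + \<sigma> k"
    and \<tau>: "\<And>k. 0 \<le> \<tau> k" "\<tau> \<longlonglongrightarrow> 0"
    and \<sigma>: "\<And>k. 0 \<le> \<sigma> k" "summable \<sigma>"
    and div: "filterlim (\<lambda>n. \<Sum>k<n. t k) at_top sequentially"
  shows "x \<longlonglongrightarrow> z"
proof -
  define D where "D = norm (u - z)"
  define p where "p k = x k - z" for k
  define J where "J k = resolvent (c k) A (x k)" for k
  define q where "q k = 2 *\<^sub>R J k - x k - z" for k
  define \<theta> where "\<theta> k = \<bar>a k\<bar> + \<bar>b k\<bar>" for k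
  define E where "E k = t k * \<tau> k + \<sigma> k" for k
  have D0: "0 \<le> D" by (simp add: D_def)
  have \<theta>: "0 \<le> \<theta> k" "\<bar>\<alpha> k\<bar> \<le> 1 - \<theta> k" "\<theta> k \<le> 1" for k
    using budget[of k] by (auto simp: \<theta>_def)
  have t_eq: "t k = (1 - \<theta> k) * (1 + \<theta> k)" for k
    by (simp add: t_def \<theta>_def algebra_simps power2_eq_square)
  have t_ge: "1 - \<theta> k \<le> t k" for k
    unfolding t_eq using \<theta>[of k] by (simp add: mult_le_cancel_left1)
  have t_le: "t k \<le> 2 * (1 - \<theta> k)" for k
    unfolding t_eq using \<theta>[of k] mult_left_mono[of "1 + \<theta> k" 2 "1 - \<theta> k"] by simp
  have t: "0 \<le> t k" "t k \<le> 1" for k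
    using t_ge[of k] \<theta>[of k] by (auto simp: t_def)
  have E0: "0 \<le> E k" for k unfolding E_def using t \<tau> \<sigma> by simp
  have qp: "norm (q k) \<le> norm (p k)" for k
    unfolding q_def p_def J_def by (rule resolvent_reflection_le[OF mm c(1) z])
  have step: "p (Suc k) = (a k *\<^sub>R p k + b k *\<^sub>R q k) + (\<alpha> k *\<^sub>R (u - z) + g k)" for k
    using rec[of k] by (simp add: p_def q_def J_def)
  have main_le: "norm (a k *\<^sub>R p k + b k *\<^sub>R q k) \<le> \<theta> k * norm (p k)" for k
    unfolding \<theta>_def by (rule norm_combination_le[OF qp])

  obtain T where T: "\<And>k. \<tau> k \<le> T" "0 \<le> T"
  proof -
    have "Bseq \<tau>" using \<tau>(2) by (simp add: convergent_imp_Bseq convergentI)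
    then obtain T where "0 < T" "\<And>k. norm (\<tau> k) \<le> T" by (rule BseqE) auto
    with that[of T] show thesis by (metis less_imp_le abs_ge_self order_trans real_norm_def)
  qed
  \<comment> \<open>An error \<open>t \<tau> \<le> (1 - \<theta>) (2 T)\<close> fits into the convex combination with weights \<open>\<theta>\<close> and
    \<open>1 - \<theta>\<close>; the summable errors accumulate.\<close>
  define B where "B = max (norm (p 0)) (D + 2 * T) + suminf \<sigma>"
  have "norm (p k) \<le> max (norm (p 0)) (D + 2 * T) + (\<Sum>i<k. \<sigma> i)" for k
  proof (induction k)
    case (Suc k)
    let ?m = "max (norm (p 0)) (D + 2 * T) + (\<Sum>i<k. \<sigma> i)"
    have s0: "0 \<le> (\<Sum>i<k. \<sigma> i)" using \<sigma> by (simp add: sum_nonneg)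
    have "norm (p (Suc k)) \<le> norm (a k *\<^sub>R p k + b k *\<^sub>R q k) + (norm (\<alpha> k *\<^sub>R (u - z)) + norm (g k))"
      unfolding step by (intro order_trans[OF norm_triangle_ineq] add_left_mono norm_triangle_ineq)
    also have "\<dots> \<le> \<theta> k * ?m + ((1 - \<theta> k) * D + ((1 - \<theta> k) * (2 * T) + \<sigma> k))"
    proof (intro add_mono)
      show "norm (a k *\<^sub>R p k + b k *\<^sub>R q k) \<le> \<theta> k * ?m"
        using main_le[of k] mult_left_mono[OF Suc.IH \<theta>(1)[of k]] by linarith
      show "norm (\<alpha> k *\<^sub>R (u - z)) \<le> (1 - \<theta> k) * D"
        using mult_right_mono[OF \<theta>(2)[of k] D0] by (simp add: D_def)
      have "t k * \<tau> k \<le> 2 * (1 - \<theta> k) * T"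
        using t_le[of k] T \<tau>(1)[of k] \<theta>[of k] by (intro mult_mono) auto
      then show "norm (g k) \<le> (1 - \<theta> k) * (2 * T) + \<sigma> k" using g[of k] by (simp add: mult_ac)
    qed
    also have "\<dots> = \<theta> k * ?m + (1 - \<theta> k) * (D + 2 * T) + \<sigma> k" by (simp add: algebra_simps)
    also have "\<dots> \<le> \<theta> k * ?m + (1 - \<theta> k) * ?m + \<sigma> k"
      using \<theta>(3)[of k] s0 by (intro add_left_mono add_right_mono mult_left_mono) auto
    also have "\<dots> = ?m + \<sigma> k" by (simp add: algebra_simps)
    finally show ?case by simp
  qed simp
  moreover have "(\<Sum>i<k. \<sigma> i) \<le> suminf \<sigma>" for k using \<sigma> by (intro sum_le_suminf) auto
  ultimately have B: "norm (p k) \<le> B" for k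
    unfolding B_def by (meson add_left_mono order_trans)
  have B0: "0 \<le> B" using B[of 0] norm_ge_zero[of "p 0"] by linarith

  define C where "C = 2 * B * (1 + D)"
  define m where "m k = max (inner (u - z) (p (Suc k))) 0" for k
  define s where "s k = (norm (p k))\<^sup>2" for k
  have C0: "0 \<le> C" using B0 D0 by (simp add: C_def)
  have split: "s (Suc k) \<le> (norm (a k *\<^sub>R p k + b k *\<^sub>R q k))\<^sup>2
      + 2 * (\<alpha> k * inner (u - z) (p (Suc k)) + inner (g k) (p (Suc k)))" for k
  proof -
    \<comment> \<open>Keeping \<open>v + w\<close> in the inner product makes the angle appear at the index \<open>k + 1\<close>.\<close>
    have sq: "(norm (v + w))\<^sup>2 \<le> (norm v)\<^sup>2 + 2 * inner w (v + w)" for v w :: 'a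
    proof -
      have "(norm v)\<^sup>2 + 2 * inner w (v + w) = (norm (v + w))\<^sup>2 + (norm w)\<^sup>2"
        by (simp add: power2_norm_eq_inner inner_simps inner_commute)
      then show ?thesis by (smt (verit) zero_le_power2)
    qed
    from sq[of "a k *\<^sub>R p k + b k *\<^sub>R q k" "\<alpha> k *\<^sub>R (u - z) + g k"]
    show ?thesis unfolding s_def step[symmetric] by (simp add: inner_add_left)
  qed
  have g_inner: "inner (g k) (p (Suc k)) \<le> E k * B" for k
    using norm_cauchy_schwarz[of "g k" "p (Suc k)"] mult_mono[OF g[of k] B[of "Suc k"]] E0[of k]
    by (simp add: E_def)
  have u_inner: "\<bar>inner (u - z) (p (Suc k))\<bar> \<le> D * B" for k
    using Cauchy_Schwarz_ineq2[of "u - z" "p (Suc k)"] mult_left_mono[OF B[of "Suc k"] D0]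
    by (simp add: D_def)

  have "s \<longlonglongrightarrow> 0"
  proof (rule contraction_or_drop_tendsto_zero[where M = "B\<^sup>2" and t = t
        and b = "\<lambda>k. 2 * m k + C * \<tau> k" and \<epsilon> = "\<lambda>k. C * \<sigma> k"])
    fix k
    show "s k \<le> B\<^sup>2" unfolding s_def using B by (simp add: power_mono)
    have "(norm (a k *\<^sub>R p k + b k *\<^sub>R q k))\<^sup>2 \<le> (\<theta> k * norm (p k))\<^sup>2"
      using main_le by (simp add: power_mono)
    also have "\<dots> = (1 - t k) * s k" by (simp add: t_def \<theta>_def s_def power_mult_distrib)
    finally have 1: "(norm (a k *\<^sub>R p k + b k *\<^sub>R q k))\<^sup>2 \<le> (1 - t k) * s k" .
    have 2: "\<alpha> k * inner (u - z) (p (Suc k)) \<le> t k * m k + E k * (D * B)"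
    proof (cases "0 \<le> \<alpha> k")
      case True
      then have "\<alpha> k * inner (u - z) (p (Suc k)) \<le> t k * m k"
        using \<theta>(2)[of k] t_ge[of k] t[of k]
        by (intro order_trans[OF mult_left_mono mult_right_mono]) (auto simp: m_def)
      moreover have "0 \<le> E k * (D * B)" using E0 D0 B0 by simp
      ultimately show ?thesis by simp
    next
      case False
      have "\<alpha> k * inner (u - z) (p (Suc k)) \<le> \<bar>\<alpha> k\<bar> * \<bar>inner (u - z) (p (Suc k))\<bar>"
        by (metis abs_ge_self abs_mult)
      also have "\<dots> \<le> E k * (D * B)"
        using False \<alpha>neg[of k] u_inner[of k] E0[of k] by (intro mult_mono) (auto simp: E_def)
      finally show ?thesis using t(1)[of k] by (simp add: m_def add_increasing)
    qed
    have "s (Suc k) \<le> (1 - t k) * s k + 2 * (t k * m k + E k * (D * B) + E k * B)"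
      using split[of k] 1 2 g_inner[of k] by argo
    also have "\<dots> = (1 - t k) * s k + t k * (2 * m k + C * \<tau> k) + C * \<sigma> k"
      by (simp add: C_def E_def algebra_simps)
    finally show "s (Suc k) \<le> (1 - t k) * s k + t k * (2 * m k + C * \<tau> k) + C * \<sigma> k" .
  next
    fix \<eta> :: real assume \<eta>: "0 < \<eta>"
    obtain \<rho>1 where \<rho>1: "0 < \<rho>1" "\<And>c x. \<lbrakk>c0 \<le> c; norm (x - z) \<le> B; norm (x - resolvent c A x) \<le> \<rho>1\<rbrakk>
        \<Longrightarrow> inner (u - z) (resolvent c A x - z) \<le> \<eta> / 8"
      using resolvent_almost_fixed_angle[OF mm z lim c(2) B0, of "\<eta> / 8"] \<eta> by auto
    define \<rho> where "\<rho> = min \<rho>1 (\<eta> / 16 / (D + 1))"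
    have \<rho>: "0 < \<rho>" "\<rho> \<le> \<rho>1" "D * \<rho> \<le> \<eta> / 16"
    proof -
      show "0 < \<rho>" "\<rho> \<le> \<rho>1" using \<rho>1(1) \<eta> D0 by (auto simp: \<rho>_def)
      have "D * \<rho> \<le> (D + 1) * (\<eta> / 16 / (D + 1))"
        using D0 \<open>0 < \<rho>\<close> by (intro mult_mono) (auto simp: \<rho>_def)
      also have "\<dots> = \<eta> / 16"
        using D0 by (subst times_divide_eq_right, subst nonzero_mult_div_cancel_left) auto
      finally show "D * \<rho> \<le> \<eta> / 16" .
    qed
    have E_lim: "E \<longlonglongrightarrow> 0"
    proof (rule tendsto_sandwich[OF _ _ tendsto_const])
      show "(\<lambda>k. \<tau> k + \<sigma> k) \<longlonglongrightarrow> 0"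
        using tendsto_add[OF \<tau>(2) summable_LIMSEQ_zero[OF \<sigma>(2)]] by simp
      show "\<forall>\<^sub>F k in sequentially. E k \<le> \<tau> k + \<sigma> k"
        unfolding E_def using t \<tau>(1) by (auto intro!: always_eventually mult_left_le_one_le)
    qed (use E0 in simp)
    \<comment> \<open>Null sequences: \<open>o1\<close> bounds the part of \<open>D * |x (k + 1) - J (x k)|\<close> that does not come from
      \<open>x k - J (x k)\<close>, and \<open>o2\<close> the error in the decrease estimate.\<close>
    define o1 where "o1 k = D * (\<bar>\<alpha> k\<bar> * D + E k + \<bar>a k + b k - 1\<bar> * B)" for k
    define o2 where "o2 k = 2 * (\<bar>\<alpha> k\<bar> * (D * B) + E k * B)" for k
    have "o1 \<longlonglongrightarrow> D * (\<bar>0\<bar> * D + 0 + \<bar>1 - 1\<bar> * B)"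
      unfolding o1_def by (intro tendsto_intros \<alpha>0 E_lim ab1)
    then have "o1 \<longlonglongrightarrow> 0" by simp
    then have ev1: "\<forall>\<^sub>F k in sequentially. o1 k < \<eta> / 16" by (rule order_tendstoD) (use \<eta> in simp)
    have "o2 \<longlonglongrightarrow> 2 * (\<bar>0\<bar> * (D * B) + 0 * B)"
      unfolding o2_def by (intro tendsto_intros \<alpha>0 E_lim)
    then have "o2 \<longlonglongrightarrow> 0" by simp
    then have ev2: "\<forall>\<^sub>F k in sequentially. o2 k < 2 * \<kappa>\<^sup>2 * \<rho>\<^sup>2"
      by (rule order_tendstoD) (use \<rho> \<kappa>(1) in simp)
    have "(\<lambda>k. C * \<tau> k) \<longlonglongrightarrow> C * 0" by (intro tendsto_intros \<tau>)
    then have "(\<lambda>k. C * \<tau> k) \<longlonglongrightarrow> 0" by simp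
    then have ev3: "\<forall>\<^sub>F k in sequentially. C * \<tau> k < \<eta> / 2"
      by (rule order_tendstoD) (use \<eta> in simp)
    have "\<forall>\<^sub>F k in sequentially. 2 * m k + C * \<tau> k \<le> \<eta> \<or> s (Suc k) \<le> s k - 2 * \<kappa>\<^sup>2 * \<rho>\<^sup>2"
      using ev1 ev2 ev3 \<kappa>(2,3) c(3)
    proof eventually_elim
      case (elim k)
      have h: "p k = (J k - z) + (x k - J k)" "q k = (J k - z) - (x k - J k)"
        by (simp_all add: p_def q_def scaleR_2)
      show ?case
      proof (cases "norm (x k - J k) \<le> \<rho>")
        case True
        have JB: "norm (J k - z) \<le> B"
          using resolvent_dist_le[OF mm c(1) z, of k "x k"] B[of k] by (simp add: J_def p_def)
        have ab: "\<bar>a k - b k\<bar> \<le> 1" using \<theta>(3)[of k] by (simp add: \<theta>_def)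
        have "p (Suc k) - (J k - z) =
            \<alpha> k *\<^sub>R (u - z) + g k + (a k + b k - 1) *\<^sub>R (J k - z) + (a k - b k) *\<^sub>R (x k - J k)"
          unfolding step h by (simp add: algebra_simps)
        also have "norm \<dots> \<le> \<bar>\<alpha> k\<bar> * D + E k + \<bar>a k + b k - 1\<bar> * B + 1 * \<rho>"
        proof (intro order_trans[OF norm_triangle_ineq] add_mono)
          show "norm ((a k - b k) *\<^sub>R (x k - J k)) \<le> 1 * \<rho>"
            unfolding norm_scaleR using ab True by (intro mult_mono) auto
        qed (use g[of k] JB in \<open>auto simp: D_def E_def intro!: mult_left_mono\<close>)
        finally have "D * norm (p (Suc k) - (J k - z)) \<le> o1 k + D * \<rho>"
          using mult_left_mono[OF _ D0] unfolding o1_def by (fastforce simp: algebra_simps)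
        then have "inner (u - z) (p (Suc k) - (J k - z)) \<le> \<eta> / 8"
          using norm_cauchy_schwarz[of "u - z" "p (Suc k) - (J k - z)"] elim \<rho>(3)
          unfolding D_def by linarith
        moreover have "inner (u - z) (J k - z) \<le> \<eta> / 8"
          using \<rho>1(2)[of "c k" "x k"] elim True \<rho>(2) B[of k] by (simp add: J_def p_def)
        ultimately have "inner (u - z) (p (Suc k)) \<le> \<eta> / 4" by (simp add: inner_diff_right)
        then have "2 * m k \<le> \<eta> / 2" using \<eta> by (simp add: m_def)
        then show ?thesis using elim by linarith
      next
        case False
        have "s (Suc k) \<le> (norm (p k))\<^sup>2 - \<kappa>\<^sup>2 * (norm (p k - q k))\<^sup>2 + o2 k"
        proof -
          have "\<alpha> k * inner (u - z) (p (Suc k)) \<le> \<bar>\<alpha> k\<bar> * (D * B)"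
            using u_inner[of k] by (metis abs_ge_self abs_ge_zero abs_mult mult_left_mono order_trans)
          moreover have "(norm (a k *\<^sub>R p k + b k *\<^sub>R q k))\<^sup>2 \<le> (norm (p k))\<^sup>2 - \<kappa>\<^sup>2 * (norm (p k - q k))\<^sup>2"
            using elim \<kappa>(1) \<theta>(3)[of k] by (intro norm_combination_gap qp) (auto simp: \<theta>_def)
          ultimately show ?thesis using split[of k] g_inner[of k] unfolding o2_def by argo
        qed
        moreover have "p k - q k = 2 *\<^sub>R (x k - J k)" by (simp add: h scaleR_2)
        moreover have "\<rho>\<^sup>2 \<le> (norm (x k - J k))\<^sup>2" using False \<rho> by (intro power_mono) auto
        then have "\<kappa>\<^sup>2 * \<rho>\<^sup>2 \<le> \<kappa>\<^sup>2 * (norm (x k - J k))\<^sup>2" by (rule mult_left_mono) simp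
        ultimately show ?thesis using elim by (simp add: s_def power_mult_distrib)
      qed
    qed
    moreover have "0 < 2 * \<kappa>\<^sup>2 * \<rho>\<^sup>2" using \<kappa>(1) \<rho>(1) by simp
    ultimately show "\<exists>\<rho>>0. \<forall>\<^sub>F k in sequentially. 2 * m k + C * \<tau> k \<le> \<eta> \<or> s (Suc k) \<le> s k - \<rho>"
      by blast
  qed (use t div C0 \<sigma> in \<open>auto simp: s_def intro: summable_mult\<close>)
  then have "(\<lambda>k. norm (x k - z)) \<longlonglongrightarrow> 0"
    using tendsto_real_sqrt[of s 0 sequentially] by (simp add: s_def[abs_def] p_def)
  then show ?thesis by (metis LIM_zero_cancel tendsto_norm_zero_iff)
qed

section \<open>Reduction of the four parameter regimes\<close>

theorem theorem4p4:
  fixes A :: "'a::{real_inner, complete_space} \<Rightarrow> 'a set"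
    and u :: 'a
    and x e :: "nat \<Rightarrow> 'a"
    and c \<alpha> \<beta> \<gamma> \<delta> :: "nat \<Rightarrow> real"
  assumes nontrivial: "(UNIV :: 'a set) \<noteq> {0}"
    and maxmon: "maximally_monotone A"
    and zer: "zer A \<noteq> {}"
    and c_pos: "\<forall>k. c k > 0"
    and x_rec: "\<forall>k. x (Suc k) =
          \<alpha> k *\<^sub>R u + \<beta> k *\<^sub>R x k + \<gamma> k *\<^sub>R resolvent (c k) A (x k) + \<delta> k *\<^sub>R e k"
    and diverges: "filterlim
          (\<lambda>n. \<Sum>k<n. 1 - (\<bar>\<beta> k + \<gamma> k / 2\<bar> + \<bar>\<gamma> k / 2\<bar>)\<^sup>2) at_top sequentially"
    and cases:
      "\<comment> \<open>(i)\<close>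
       ((\<forall>k. \<bar>\<alpha> k\<bar> + \<bar>\<beta> k + \<gamma> k / 2\<bar> + \<bar>\<gamma> k / 2\<bar> \<le> 1
            \<and> \<beta> k + \<gamma> k \<ge> 0
            \<and> (\<bar>\<beta> k + \<gamma> k / 2\<bar> + \<bar>\<gamma> k / 2\<bar>)\<^sup>2 - \<beta> k - \<gamma> k \<le> 0)
        \<and> summable (\<lambda>k. \<bar>1 - \<alpha> k - \<beta> k - \<gamma> k\<bar>)
        \<and> summable (\<lambda>k. norm (\<delta> k *\<^sub>R e k))
        \<and> \<alpha> \<longlonglongrightarrow> 0 \<and> \<beta> \<longlonglongrightarrow> 0 \<and> \<gamma> \<longlonglongrightarrow> 1
        \<and> filterlim c at_top sequentially)
       \<or> \<comment> \<open>(ii)\<close>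
       ((\<forall>k. \<bar>\<alpha> k\<bar> + \<bar>\<beta> k + \<gamma> k / 2\<bar> + \<bar>\<gamma> k / 2\<bar> \<le> 1
            \<and> \<beta> k + \<gamma> k \<ge> 0
            \<and> (\<bar>\<beta> k + \<gamma> k / 2\<bar> + \<bar>\<gamma> k / 2\<bar>)\<^sup>2 - \<beta> k - \<gamma> k \<le> 0)
        \<and> summable (\<lambda>k. \<bar>1 - \<alpha> k - \<beta> k - \<gamma> k\<bar>)
        \<and> summable (\<lambda>k. norm (\<delta> k *\<^sub>R e k))
        \<and> \<alpha> \<longlonglongrightarrow> 0
        \<and> limsup (\<lambda>k. ereal \<bar>\<beta> k\<bar>) < 1
        \<and> 0 < liminf (\<lambda>k. ereal (1 - \<beta> k - \<gamma> k / 2))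
        \<and> liminf (\<lambda>k. ereal (1 - \<beta> k - \<gamma> k / 2)) \<le> limsup (\<lambda>k. ereal (1 - \<beta> k - \<gamma> k / 2))
        \<and> limsup (\<lambda>k. ereal (1 - \<beta> k - \<gamma> k / 2)) < 1
        \<and> (\<lambda>k. 1 - c k / c (Suc k)) \<longlonglongrightarrow> 0
        \<and> ((INF k. c k) > 0 \<or> filterlim c at_top sequentially))
       \<or> \<comment> \<open>(iii)\<close>
       ((\<forall>k. \<bar>\<alpha> k\<bar> + \<bar>\<beta> k + \<gamma> k / 2\<bar> + \<bar>\<gamma> k / 2\<bar> \<le> 1
            \<and> \<beta> k + \<gamma> k \<ge> 0
            \<and> (\<bar>\<beta> k + \<gamma> k / 2\<bar> + \<bar>\<gamma> k / 2\<bar>)\<^sup>2 - \<beta> k - \<gamma> k \<le> 0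
            \<and> \<bar>\<gamma> k\<bar> \<in> {0..1})
        \<and> summable (\<lambda>k. \<bar>(\<alpha> (Suc k) + \<gamma> (Suc k)) - (\<alpha> k + \<gamma> k)\<bar>)
        \<and> summable (\<lambda>k. \<bar>1 - \<alpha> k - \<beta> k - \<gamma> k\<bar>)
        \<and> summable (\<lambda>k. \<bar>\<beta> k\<bar>)
        \<and> filterlim (\<lambda>n. \<Sum>k<n. 1 - \<bar>\<gamma> k\<bar>) at_top sequentially
        \<and> summable (\<lambda>k. norm (\<delta> k *\<^sub>R e k))
        \<and> (summable (\<lambda>k. \<bar>\<alpha> (Suc k) - \<alpha> k\<bar>)
           \<or> ((\<forall>k. \<bar>\<gamma> k\<bar> \<noteq> 1)
              \<and> (\<lambda>k. \<bar>\<alpha> (Suc k) - \<alpha> k\<bar> / (1 - \<bar>\<gamma> (Suc k)\<bar>)) \<longlonglongrightarrow> 0))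
        \<and> \<alpha> \<longlonglongrightarrow> 0 \<and> (\<lambda>k. \<alpha> k + \<gamma> k) \<longlonglongrightarrow> 1
        \<and> (INF k. c k) > 0
        \<and> summable (\<lambda>k. \<bar>c (Suc k) - c k\<bar>))
       \<or> \<comment> \<open>(iv)\<close>
       ((\<forall>k. \<alpha> k \<in> {0<..1} \<and> \<alpha> k + \<bar>\<beta> k + \<gamma> k / 2\<bar> + \<bar>\<gamma> k / 2\<bar> \<le> 1)
        \<and> \<alpha> \<longlonglongrightarrow> 0 \<and> \<beta> \<longlonglongrightarrow> 0 \<and> \<gamma> \<longlonglongrightarrow> 1
        \<and> (\<lambda>k. (\<delta> k *\<^sub>R e k) /\<^sub>R \<alpha> k) \<longlonglongrightarrow> 0
        \<and> (\<lambda>k. (1 - \<alpha> k - \<beta> k - \<gamma> k) / \<alpha> k) \<longlonglongrightarrow> 0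
        \<and> filterlim c at_top sequentially)"
  shows "x \<longlonglongrightarrow> projector (zer A) u"
proof -
  obtain z where z: "z \<in> zer A" and lim: "(\<lambda>n. resolvent (real (Suc n)) A u) \<longlonglongrightarrow> z"
    and proj: "projector (zer A) u = z"
    using resolvent_limit[OF maxmon zer] .
  \<comment> \<open>In terms of the reflection \<open>2 J - Id\<close>, the iteration has these coefficients; \<open>r\<close> is the amount
    by which the coefficients miss summing to \<open>1\<close>.\<close>
  define a where "a k = \<beta> k + \<gamma> k / 2" for k
  define b where "b k = \<gamma> k / 2" for k
  define r where "r k = 1 - \<alpha> k - \<beta> k - \<gamma> k" for k
  define g where "g k = \<delta> k *\<^sub>R e k - r k *\<^sub>R z" for k
  have ab: "a k + b k = \<beta> k + \<gamma> k" for k by (simp add: a_def b_def)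
  have rec: "x (Suc k) - z = \<alpha> k *\<^sub>R (u - z) + a k *\<^sub>R (x k - z)
      + b k *\<^sub>R (2 *\<^sub>R resolvent (c k) A (x k) - x k - z) + g k" for k
  proof -
    define y where "y = resolvent (c k) A (x k)"
    have coeffs: "\<beta> k = a k - b k" "\<gamma> k = 2 * b k" "r k = 1 - \<alpha> k - a k - b k"
      by (auto simp: a_def b_def r_def)
    show ?thesis
      unfolding x_rec[rule_format] g_def y_def[symmetric] coeffs by (simp add: algebra_simps)
  qed
  have g_le: "norm (g k) \<le> norm (\<delta> k *\<^sub>R e k) + \<bar>r k\<bar> * norm z" for k
    unfolding g_def by (rule order_trans[OF norm_triangle_ineq4]) simp
  have div: "filterlim (\<lambda>n. \<Sum>k<n. 1 - (\<bar>a k\<bar> + \<bar>b k\<bar>)\<^sup>2) at_top sequentially"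
    using diverges by (simp add: a_def b_def)
  note engine = perturbed_resolvent_iteration[where x = x and g = g and a = a and b = b,
      OF maxmon z lim c_pos[rule_format] _ _ rec]

  have summable_case: "x \<longlonglongrightarrow> z"
    if budget: "\<And>k. \<bar>\<alpha> k\<bar> + \<bar>a k\<bar> + \<bar>b k\<bar> \<le> 1"
      and r: "summable (\<lambda>k. \<bar>r k\<bar>)" and e: "summable (\<lambda>k. norm (\<delta> k *\<^sub>R e k))"
      and \<alpha>: "\<alpha> \<longlonglongrightarrow> 0"
      and \<kappa>: "0 < \<kappa>" "\<forall>\<^sub>F k in sequentially. \<kappa> \<le> a k" "\<forall>\<^sub>F k in sequentially. \<kappa> \<le> b k"
      and c0: "0 < c0" "\<forall>\<^sub>F k in sequentially. c0 \<le> c k" for \<kappa> c0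
  proof (rule engine[OF c0 budget \<alpha> \<kappa>, where \<tau> = "\<lambda>_. 0"
        and \<sigma> = "\<lambda>k. norm (\<delta> k *\<^sub>R e k) + \<bar>r k\<bar> * (norm z + 1)"])
    have "(\<lambda>k. 1 - \<alpha> k - r k) \<longlonglongrightarrow> 1 - 0 - 0"
      using summable_LIMSEQ_zero[OF r] by (intro tendsto_intros \<alpha>) (simp add: tendsto_rabs_zero_iff)
    then show "(\<lambda>k. a k + b k) \<longlonglongrightarrow> 1" by (simp add: ab r_def algebra_simps)
    fix k
    show "norm (g k) \<le> (1 - (\<bar>a k\<bar> + \<bar>b k\<bar>)\<^sup>2) * 0 + (norm (\<delta> k *\<^sub>R e k) + \<bar>r k\<bar> * (norm z + 1))"
      using g_le[of k] by (simp add: algebra_simps)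
    \<comment> \<open>Since \<open>1 - \<alpha> - r = a + b \<le> 1 - |\<alpha>|\<close>, one has \<open>2 |\<alpha>| \<le> |r|\<close> whenever \<open>\<alpha> < 0\<close>.\<close>
    have "- \<alpha> k \<le> \<bar>r k\<bar>"
      using budget[of k] ab[of k] by (simp add: r_def)
    also have "\<dots> \<le> norm (\<delta> k *\<^sub>R e k) + \<bar>r k\<bar> * (norm z + 1)" by (simp add: algebra_simps)
    finally show "- \<alpha> k \<le> (1 - (\<bar>a k\<bar> + \<bar>b k\<bar>)\<^sup>2) * 0
        + (norm (\<delta> k *\<^sub>R e k) + \<bar>r k\<bar> * (norm z + 1))" by simp
  qed (use r e div in \<open>auto intro!: summable_add summable_mult2\<close>)

  have half: "\<forall>\<^sub>F k in sequentially. 1 / 4 \<le> a k" "\<forall>\<^sub>F k in sequentially. 1 / 4 \<le> b k"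
    if \<beta>: "\<beta> \<longlonglongrightarrow> 0" and \<gamma>: "\<gamma> \<longlonglongrightarrow> 1"
  proof -
    have "a \<longlonglongrightarrow> 0 + 1 / 2" "b \<longlonglongrightarrow> 1 / 2"
      unfolding a_def b_def by (intro tendsto_intros \<beta> \<gamma> | simp)+
    then have "\<forall>\<^sub>F k in sequentially. 1 / 4 < a k" "\<forall>\<^sub>F k in sequentially. 1 / 4 < b k"
      by - (erule order_tendstoD(1), simp)+
    then show "\<forall>\<^sub>F k in sequentially. 1 / 4 \<le> a k" "\<forall>\<^sub>F k in sequentially. 1 / 4 \<le> b k"
      by (auto elim: eventually_mono)
  qed
  have c_large: "\<forall>\<^sub>F k in sequentially. 1 \<le> c k" if "filterlim c at_top sequentially"
    using that by (simp add: filterlim_at_top)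
  have c_INF: "\<forall>\<^sub>F k in sequentially. (INF k. c k) \<le> c k"
    using c_pos by (intro always_eventually allI cINF_lower bdd_belowI2[of _ 0]) (auto simp: less_imp_le)

  from cases have "x \<longlonglongrightarrow> z"
    unfolding a_def[symmetric] r_def[symmetric]
    unfolding b_def[symmetric]
  proof (elim disjE, goal_cases)
    case 1
    then show ?case
      by (intro summable_case[of "1 / 4" 1] half c_large) auto
  next
    case 2
    then have limits: "limsup (\<lambda>k. ereal (1 - \<beta> k - b k)) < ereal 1"
        "ereal 0 < liminf (\<lambda>k. ereal (1 - \<beta> k - b k))"
      by (auto simp: one_ereal_def zero_ereal_def)
    from ereal_dense2[OF limits(1)] obtain h
      where h: "limsup (\<lambda>k. ereal (1 - \<beta> k - b k)) < ereal h" "h < 1" by auto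
    from ereal_dense2[OF limits(2)] obtain l
      where l: "ereal l < liminf (\<lambda>k. ereal (1 - \<beta> k - b k))" "0 < l" by auto
    \<comment> \<open>Of the weights, \<open>a\<close> is bounded away from \<open>0\<close> and \<open>1\<close>, and \<open>a + b\<close> tends to \<open>1\<close>, so \<open>b\<close> is bounded
      away from \<open>0\<close> as well.\<close>
    have eh: "\<forall>\<^sub>F k in sequentially. 1 - a k < h"
      using Limsup_lessD[OF h(1)] by (simp add: a_def b_def algebra_simps)
    have el: "\<forall>\<^sub>F k in sequentially. l < 1 - a k"
      using less_LiminfD[OF l(1)] by (simp add: a_def b_def algebra_simps)
    have "(\<lambda>k. \<alpha> k + r k) \<longlonglongrightarrow> 0 + 0"
      using 2 summable_LIMSEQ_zero[of "\<lambda>k. \<bar>r k\<bar>"]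
      by (intro tendsto_intros) (auto simp: tendsto_rabs_zero_iff)
    then have "(\<lambda>k. \<alpha> k + r k) \<longlonglongrightarrow> 0" by simp
    then have es: "\<forall>\<^sub>F k in sequentially. \<alpha> k + r k < l / 2"
      by (rule order_tendstoD) (use l(2) in simp)
    obtain c0 where "0 < c0" "\<forall>\<^sub>F k in sequentially. c0 \<le> c k"
      using 2 c_INF c_large zero_less_one by blast
    moreover have "\<forall>\<^sub>F k in sequentially. min (1 - h) (l / 2) \<le> a k"
      using eh by eventually_elim auto
    moreover have "\<forall>\<^sub>F k in sequentially. min (1 - h) (l / 2) \<le> b k"
      using el es
    proof eventually_elim
      case (elim k)
      then show ?case using ab[of k] unfolding r_def by linarith
    qed
    ultimately show ?case
      using 2 h(2) l(2) by (intro summable_case[of "min (1 - h) (l / 2)" c0]) auto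
  next
    case 3
    then have \<beta>: "\<beta> \<longlonglongrightarrow> 0"
      using summable_LIMSEQ_zero[of "\<lambda>k. \<bar>\<beta> k\<bar>"] by (auto simp: tendsto_rabs_zero_iff)
    have "(\<lambda>k. (\<alpha> k + \<gamma> k) - \<alpha> k) \<longlonglongrightarrow> 1 - 0" using 3 by (intro tendsto_diff) auto
    then have "\<gamma> \<longlonglongrightarrow> 1" by simp
    with 3 \<beta> show ?case
      by (intro summable_case[of "1 / 4" "INF k. c k"] half c_INF) auto
  next
    case 4
    \<comment> \<open>Here the errors are \<open>o(\<alpha>)\<close>, and \<open>\<alpha> \<le> t\<close>.\<close>
    define \<tau> where "\<tau> k = \<bar>r k / \<alpha> k\<bar> * norm z + norm ((\<delta> k *\<^sub>R e k) /\<^sub>R \<alpha> k)" for k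
    have \<alpha>_pos: "0 < \<alpha> k" for k using 4 by auto
    have budget: "\<bar>\<alpha> k\<bar> + \<bar>a k\<bar> + \<bar>b k\<bar> \<le> 1" for k
    proof -
      have "\<alpha> k + \<bar>a k\<bar> + \<bar>b k\<bar> \<le> 1" using 4 by blast
      then show ?thesis using \<alpha>_pos[of k] by linarith
    qed
    have rel_lims: "(\<lambda>k. r k / \<alpha> k) \<longlonglongrightarrow> 0" "(\<lambda>k. (\<delta> k *\<^sub>R e k) /\<^sub>R \<alpha> k) \<longlonglongrightarrow> 0"
      using 4 by blast+
    have \<alpha>_le: "\<alpha> k \<le> 1 - (\<bar>a k\<bar> + \<bar>b k\<bar>)\<^sup>2" for k
    proof -
      have "(\<bar>a k\<bar> + \<bar>b k\<bar>)\<^sup>2 \<le> \<bar>a k\<bar> + \<bar>b k\<bar>"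
        using budget[of k] mult_left_le[of "\<bar>a k\<bar> + \<bar>b k\<bar>" "\<bar>a k\<bar> + \<bar>b k\<bar>"]
        by (simp add: power2_eq_square)
      then show ?thesis using budget[of k] \<alpha>_pos[of k] by linarith
    qed
    have "(\<lambda>k. \<bar>r k / \<alpha> k\<bar> * norm z + norm ((\<delta> k *\<^sub>R e k) /\<^sub>R \<alpha> k)) \<longlonglongrightarrow> \<bar>0\<bar> * norm z + norm (0 :: 'a)"
      by (intro tendsto_intros rel_lims)
    then have \<tau>_lim: "\<tau> \<longlonglongrightarrow> 0" by (simp add: \<tau>_def[abs_def])
    have \<tau>0: "0 \<le> \<tau> k" for k by (simp add: \<tau>_def)
    have c1: "\<forall>\<^sub>F k in sequentially. 1 \<le> c k" using 4 c_large by blast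
    have \<alpha>0: "\<alpha> \<longlonglongrightarrow> 0" and \<beta>\<gamma>: "\<beta> \<longlonglongrightarrow> 0" "\<gamma> \<longlonglongrightarrow> 1" using 4 by auto
    show ?case
    proof (rule engine[OF _ c1 budget \<alpha>0 _ half[OF \<beta>\<gamma>], where \<tau> = \<tau> and \<sigma> = "\<lambda>_. 0"])
      show "(\<lambda>k. a k + b k) \<longlonglongrightarrow> 1" using tendsto_add[OF \<beta>\<gamma>] by (simp add: ab)
      fix k
      have "norm (g k) \<le> norm (\<delta> k *\<^sub>R e k) + \<bar>r k\<bar> * norm z" by (rule g_le)
      also have "\<dots> = \<alpha> k * \<tau> k"
        using \<alpha>_pos[of k] by (simp add: \<tau>_def abs_mult field_simps)
      also have "\<dots> \<le> (1 - (\<bar>a k\<bar> + \<bar>b k\<bar>)\<^sup>2) * \<tau> k"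
        using \<alpha>_le \<tau>0 by (rule mult_right_mono)
      finally show "norm (g k) \<le> (1 - (\<bar>a k\<bar> + \<bar>b k\<bar>)\<^sup>2) * \<tau> k + 0" by simp
      have "0 \<le> (1 - (\<bar>a k\<bar> + \<bar>b k\<bar>)\<^sup>2) * \<tau> k"
        using \<alpha>_le[of k] \<alpha>_pos[of k] \<tau>0[of k] by (intro mult_nonneg_nonneg) auto
      then show "- \<alpha> k \<le> (1 - (\<bar>a k\<bar> + \<bar>b k\<bar>)\<^sup>2) * \<tau> k + 0" using \<alpha>_pos[of k] by linarith
    qed (use \<tau>0 \<tau>_lim div in auto)
  qed
  then show ?thesis by (simp add: proj)
qed

end
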